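(* There is a polynomial $g_{\chi,diff}$ of the system variables such that for every policy $K$ with finite $C(K)$ and every policy $K'$ with $$\|K'-K\|\le\min\left(\frac{\Lambda_{\min}(Q)\,\mu}{4\,C(K)\sum_{i=1}^{N_s}\|B_i\|\,(\|A_i-B_iK_i\|+1)},\ \sum_{i=1}^{N_s}\|K_i\|\right)$$ one has $$\|\chi_{K'}-\chi_{K}\|\le g_{\chi,diff}\,\|K'-K\|.$$
   Context: Setting (a fixed Markovian jump linear system). Let $\Omega=\{1,\dots,N_s\}$ and let $\omega(t)$, $t\ge0$, be a time-homogeneous Markov chain on $\Omega$ with transition probabilities $p_{ij}=\mathbb P(\omega(t+1)=j\mid\omega(t)=i)$ and initial distribution $\pi$. The state $x_t\in\mathbb R^d$ and control $u_t\in\mathbb R^k$ satisfy $x_{t+1}=A_{\omega(t)}x_t+B_{\omega(t)}u_t$, with $A_i\in\mathbb R^{d\times d}$, $B_i\in\mathbb R^{d\times k}$ and $x_0\sim D$ independent of the chain. A policy is a tuple $K=(K_1,\dots,K_{N_s})$, $K_i\in\mathbb R^{k\times d}$, acting by $u_t=-K_{\omega(t)}x_t$; its cost is $C(K)=\mathbb E_{x_0\sim D,\,\omega(0)\sim\pi}\big[\sum_{t=0}^\infty x_t^\top Q_{\omega(t)}x_t+u_t^\top R_{\omega(t)}u_t\big]$. Standing assumptions: all $Q_i\succ0$, all $R_i\succ0$, all $\pi_i>0$, $\mathbb E_{x_0\sim D}[x_0x_0^\top]\succ0$, and the system can be mean-square stabilized. Notation: $\|\cdot\|$ on matrices is the maximal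 singular value; for a tuple $V=(V_1,\dots,V_{N_s})$, $\|V\|=\max_i\|V_i\|$ and $\Lambda_{\min}(V)=\min_i\sigma_{\min}(V_i)$; $\mu=\min_i\pi_i\cdot\sigma_{\min}(\mathbb E_{x_0\sim D}[x_0x_0^\top])$. With $X_i(t)=\mathbb E[x_tx_t^\top\mathbf 1_{\omega(t)=i}]$ under policy $K$, $\chi_K=\mathrm{diag}\big(\sum_{t\ge0}X_1(t),\dots,\sum_{t\ge0}X_{N_s}(t)\big)$. "System variables" are the quantities $\|A\|,\|B\|,\|Q\|,\|R\|,\|K\|,C(K)/\Lambda_{\min}(Q)$; the coefficients of the polynomial may depend on the fixed system but not on $K,K'$. *)

theory Defs
  imports "HOL-Probability.Probability"
begin

(* Square roots of the eigenvalues of transpose A ** A. For an m x n matrix with m < n this set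
   also contains 0, which is irrelevant for the largest singular value. *)
definition singular_values :: "real^'n^'m \<Rightarrow> real set" where
  "singular_values A =
     {sqrt l | l. \<exists>v. v \<noteq> 0 \<and> (transpose A ** A) *v v = l *\<^sub>R v}"

definition max_sv :: "real^'n^'m \<Rightarrow> real" where
  "max_sv A = Max (singular_values A)"

definition min_sv :: "real^'n^'n \<Rightarrow> real" where
  "min_sv A = Min (singular_values A)"

definition pos_def :: "real^'n^'n \<Rightarrow> bool" where
  "pos_def A \<longleftrightarrow> transpose A = A \<and> (\<forall>v. v \<noteq> 0 \<longrightarrow> v \<bullet> (A *v v) > 0)"

definition outer_square :: "real^'n \<Rightarrow> real^'n^'n" where
  "outer_square x = (\<chi> a b. x $ a * x $ b)"

definition tuple_norm :: "('s::finite \<Rightarrow> real^'n^'m) \<Rightarrow> real" where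
  "tuple_norm V = (MAX i. max_sv (V i))"

definition Lambda_min :: "('s::finite \<Rightarrow> real^'n^'n) \<Rightarrow> real" where
  "Lambda_min V = (MIN i. min_sv (V i))"

definition block_diag :: "('s::finite \<Rightarrow> real^'d^'d) \<Rightarrow> real^('s \<times> 'd)^('s \<times> 'd)" where
  "block_diag V = (\<chi> r c. if fst r = fst c then V (fst r) $ snd r $ snd c else 0)"

definition markov_chain ::
  "'w measure \<Rightarrow> (nat \<Rightarrow> 'w \<Rightarrow> 's::finite) \<Rightarrow> ('s \<Rightarrow> 's \<Rightarrow> real) \<Rightarrow> ('s \<Rightarrow> real) \<Rightarrow> bool" where
  "markov_chain M \<omega> p \<pi> \<longleftrightarrow>
     (\<forall>t. \<omega> t \<in> measurable M (count_space UNIV)) \<and>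
     (\<forall>i j. p i j \<ge> 0) \<and> (\<forall>i. (\<Sum>j\<in>UNIV. p i j) = 1) \<and>
     (\<forall>i. \<P>(w in M. \<omega> 0 w = i) = \<pi> i) \<and>
     (\<forall>t s j. \<P>(w in M. \<forall>k\<le>t. \<omega> k w = s k) > 0 \<longrightarrow>
        \<P>(w in M. \<omega> (Suc t) w = j \<bar> \<forall>k\<le>t. \<omega> k w = s k) = p (s t) j)"

(* The trajectory along a deterministic mode sequence s, started in v. *)
primrec traj ::
  "('s \<Rightarrow> real^'d^'d) \<Rightarrow> ('s \<Rightarrow> real^'k^'d) \<Rightarrow> ('s \<Rightarrow> real^'d^'k) \<Rightarrow> (nat \<Rightarrow> 's) \<Rightarrow> real^'d
     \<Rightarrow> nat \<Rightarrow> real^'d" where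
  "traj A B K s v 0 = v"
| "traj A B K s v (Suc t) =
     A (s t) *v traj A B K s v t + B (s t) *v (- (K (s t) *v traj A B K s v t))"

definition stage_cost ::
  "real^'d^'d \<Rightarrow> real^'k^'k \<Rightarrow> real^'d \<Rightarrow> real^'k \<Rightarrow> real" where
  "stage_cost Q R x u = x \<bullet> (Q *v x) + u \<bullet> (R *v u)"

(* The stage costs are nonnegative for positive definite Q and R, so the coercion to the extended
   nonnegative reals loses nothing, and an infinite cost has the value infinity. *)
definition cost ::
  "'w measure \<Rightarrow> (nat \<Rightarrow> 'w \<Rightarrow> 's) \<Rightarrow> ('w \<Rightarrow> real^'d) \<Rightarrow> ('s \<Rightarrow> real^'d^'d) \<Rightarrow> ('s \<Rightarrow> real^'k^'d)
     \<Rightarrow> ('s \<Rightarrow> real^'d^'d) \<Rightarrow> ('s \<Rightarrow> real^'k^'k) \<Rightarrow> ('s \<Rightarrow> real^'d^'k) \<Rightarrow> ennreal" where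
  "cost M \<omega> x0 A B Q R K =
     (\<integral>\<^sup>+ w. (\<Sum>t. ennreal (let x = traj A B K (\<lambda>n. \<omega> n w) (x0 w) t
                          in stage_cost (Q (\<omega> t w)) (R (\<omega> t w)) x (- (K (\<omega> t w) *v x)))) \<partial>M)"

definition mode_corr ::
  "'w measure \<Rightarrow> (nat \<Rightarrow> 'w \<Rightarrow> 's) \<Rightarrow> ('w \<Rightarrow> real^'d) \<Rightarrow> ('s \<Rightarrow> real^'d^'d) \<Rightarrow> ('s \<Rightarrow> real^'k^'d)
     \<Rightarrow> ('s \<Rightarrow> real^'d^'k) \<Rightarrow> 's \<Rightarrow> nat \<Rightarrow> real^'d^'d" where
  "mode_corr M \<omega> x0 A B K i t =
     (\<integral>w. indicator {w. \<omega> t w = i} w *\<^sub>R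
           outer_square (traj A B K (\<lambda>n. \<omega> n w) (x0 w) t) \<partial>M)"

definition chi_mat ::
  "'w measure \<Rightarrow> (nat \<Rightarrow> 'w \<Rightarrow> 's::finite) \<Rightarrow> ('w \<Rightarrow> real^'d) \<Rightarrow> ('s \<Rightarrow> real^'d^'d)
     \<Rightarrow> ('s \<Rightarrow> real^'k^'d) \<Rightarrow> ('s \<Rightarrow> real^'d^'k) \<Rightarrow> real^('s \<times> 'd)^('s \<times> 'd)" where
  "chi_mat M \<omega> x0 A B K = block_diag (\<lambda>i. \<Sum>t. mode_corr M \<omega> x0 A B K i t)"

definition second_moment :: "(real^'d) measure \<Rightarrow> real^'d^'d" where
  "second_moment D = (\<integral>x. outer_square x \<partial>D)"

definition mu :: "('s::finite \<Rightarrow> real) \<Rightarrow> (real^'d) measure \<Rightarrow> real" where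
  "mu \<pi> D = (MIN i. \<pi> i) * min_sv (second_moment D)"

(* Mean-square stability: the second moment of the state tends to 0 for every initial state v and
   every initial mode i. Starting in mode i means conditioning on the event that the initial mode
   is i, which has positive probability under the standing assumptions below. *)
definition ms_stable ::
  "'w measure \<Rightarrow> (nat \<Rightarrow> 'w \<Rightarrow> 's) \<Rightarrow> ('s \<Rightarrow> real^'d^'d) \<Rightarrow> ('s \<Rightarrow> real^'k^'d)
     \<Rightarrow> ('s \<Rightarrow> real^'d^'k) \<Rightarrow> bool" where
  "ms_stable M \<omega> A B K \<longleftrightarrow>
     (\<forall>v i. (\<lambda>t. \<integral>w. (norm (traj A B K (\<lambda>n. \<omega> n w) v t))\<^sup>2
                   \<partial>uniform_measure M {w \<in> space M. \<omega> 0 w = i}) \<longlonglongrightarrow> 0)"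

locale mjls = prob_space M
  for M :: "'w measure"
    and \<omega> :: "nat \<Rightarrow> 'w \<Rightarrow> 's::finite"
    and p :: "'s \<Rightarrow> 's \<Rightarrow> real"
    and \<pi> :: "'s \<Rightarrow> real"
    and x0 :: "'w \<Rightarrow> real^'d"
    and D :: "(real^'d) measure"
    and A :: "'s \<Rightarrow> real^'d^'d"
    and B :: "'s \<Rightarrow> real^'k^'d"
    and Q :: "'s \<Rightarrow> real^'d^'d"
    and R :: "'s \<Rightarrow> real^'k^'k" +
  assumes chain: "markov_chain M \<omega> p \<pi>"
    and x0_measurable: "x0 \<in> borel_measurable M"
    and x0_distr: "distr M borel x0 = D"
    and x0_indep: "indep_set
      (sets (vimage_algebra (space M) x0 borel))
      (sets (vimage_algebra (space M) (\<lambda>w t. \<omega> t w) (PiM UNIV (\<lambda>t. count_space UNIV))))"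
    and pi_pos: "\<And>i. \<pi> i > 0"
    and second_moment_integrable: "integrable D outer_square"
    and second_moment_pos_def: "pos_def (second_moment D)"
    and Q_pos_def: "\<And>i. pos_def (Q i)"
    and R_pos_def: "\<And>i. pos_def (R i)"
    and stabilizable: "\<exists>K. ms_stable M \<omega> A B K"

end

theory Submission
  imports Defs
begin

text \<open>
  Let \<open>S\<^sub>n\<close> be the tuple of partial sums \<open>\<Sum>t<n. X\<^sub>i(t)\<close> under \<open>K\<close> and \<open>S'\<^sub>n\<close> the one under \<open>K'\<close>. Expanding
  over the finitely many mode paths up to time \<open>t\<close> and using that \<open>x\<^sub>0\<close> is independent of the chain, one
  gets \<open>S\<^sub>n\<^sub>+\<^sub>1 = W + L S\<^sub>n\<close> with \<open>W\<^sub>i = \<pi>\<^sub>i E[x\<^sub>0 x\<^sub>0\<^sup>T]\<close> and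
  \<open>(L V)\<^sub>j = \<Sum>i. p\<^sub>i\<^sub>j F\<^sub>i V\<^sub>i F\<^sub>i\<^sup>T\<close>, where \<open>F\<^sub>i = A\<^sub>i - B\<^sub>i K\<^sub>i\<close>. The cost bounds \<open>S\<^sub>n\<close> by
  \<open>c = C(K) / \<Lambda>\<^sub>m\<^sub>i\<^sub>n(Q)\<close>, and \<open>W\<close> is at least \<open>\<mu>\<close> times the identity. If \<open>e\<close> bounds the norm of \<open>L' - L\<close>
  and \<open>2 c e \<le> \<mu>\<close>, then in the Loewner order \<open>S'\<^sub>n - S\<^sub>n\<close> lies between plus and minus
  \<open>(2 c e / \<mu>) S\<^sub>n\<close> for every \<open>n\<close>. Hence \<open>S'\<^sub>n\<close> converges and \<open>\<chi>\<close> changes by at most \<open>2 c\<^sup>2 e / \<mu>\<close>; here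
  \<open>e\<close> is \<open>2 \<parallel>K' - K\<parallel> \<Sum>i. \<parallel>B\<^sub>i\<parallel> (\<parallel>F\<^sub>i\<parallel> + 1)\<close>.
\<close>

subsection \<open>Extremal eigenvalues and singular values\<close>

text \<open>The default rule would turn every \<open>transpose A *v x\<close> into \<open>x v* A\<close>.\<close>
declare transpose_matrix_vector [simp del]

lemma inner_matrix_vector_transpose:
  fixes A :: "real^'n^'m"
  shows "x \<bullet> (A *v y) = (transpose A *v x) \<bullet> y"
  by (simp add: dot_lmul_matrix transpose_matrix_vector)

text \<open>Variational argument: the quadratic form of \<open>G\<close> attains its minimum
  \<open>l\<close> on the compact unit sphere, and the vanishing of the first variation at a
  minimizer \<open>v\<close> makes \<open>v\<close> an eigenvector.\<close>

lemma symmetric_minimal_eigenvector: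
  fixes G :: "real^'n^'n"
  assumes sym: "transpose G = G"
  obtains v l where "v \<noteq> 0" "G *v v = l *\<^sub>R v" "\<And>x. l * (norm x)\<^sup>2 \<le> x \<bullet> (G *v x)"
proof -
  have "compact (sphere (0::real^'n) 1)" by simp
  moreover have "sphere (0::real^'n) 1 \<noteq> {}" by simp
  moreover have "continuous_on (sphere 0 1) (\<lambda>x. x \<bullet> (G *v x))"
    by (intro continuous_intros linear_continuous_on matrix_vector_mul_bounded_linear)
  ultimately have "\<exists>v\<in>sphere 0 1. \<forall>x\<in>sphere 0 1. v \<bullet> (G *v v) \<le> x \<bullet> (G *v x)"
    by (rule continuous_attains_inf)
  then obtain v where v: "norm v = 1"
    and vmin: "\<And>x. norm x = 1 \<Longrightarrow> v \<bullet> (G *v v) \<le> x \<bullet> (G *v x)"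
    by auto
  define l where "l = v \<bullet> (G *v v)"
  have low: "l * (norm x)\<^sup>2 \<le> x \<bullet> (G *v x)" for x
  proof (cases "x = 0")
    case False
    then have "norm (sgn x) = 1" by (simp add: norm_sgn)
    then have "l \<le> sgn x \<bullet> (G *v sgn x)" unfolding l_def by (rule vmin)
    also have "\<dots> = (x \<bullet> (G *v x)) / (norm x)\<^sup>2"
      by (simp add: sgn_div_norm matrix_vector_mult_scaleR power2_eq_square field_class.field_divide_inverse)
    finally show ?thesis using False by (simp add: pos_le_divide_eq)
  qed simp
  have ort: "w \<bullet> (G *v v - l *\<^sub>R v) = 0" for w
  proof -
    define b where "b = w \<bullet> (G *v v - l *\<^sub>R v)"
    define c where "c = w \<bullet> (G *v w) - l * (norm w)\<^sup>2"
    \<comment> \<open>The form \<open>x \<bullet> (G *v x) - l * (norm x)\<^sup>2\<close> is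
      nonnegative everywhere and zero at \<open>v\<close>. Along the line
      \<open>v + t *\<^sub>R w\<close> it is therefore a quadratic in \<open>t\<close> without
      constant term, with slope \<open>2 * b\<close> at \<open>0\<close>.\<close>
    have q: "0 \<le> 2 * t * b + t\<^sup>2 * c" for t
    proof -
      have *: "v \<bullet> (G *v w) = w \<bullet> (G *v v)"
        using inner_matrix_vector_transpose[of v G w] sym by (simp add: inner_commute)
      have "0 \<le> (v + t *\<^sub>R w) \<bullet> (G *v (v + t *\<^sub>R w)) - l * (norm (v + t *\<^sub>R w))\<^sup>2"
        using low[of "v + t *\<^sub>R w"] by simp
      also have "\<dots> = 2 * t * b + t\<^sup>2 * c"
        unfolding b_def c_def power2_norm_eq_inner
        using * v by (simp add: matrix_vector_right_distrib matrix_vector_mult_scaleR inner_simps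
            l_def power2_eq_square algebra_simps norm_eq_1 inner_commute)
      finally show ?thesis .
    qed
    have c0: "0 \<le> c" using low[of w] by (simp add: c_def)
    \<comment> \<open>At \<open>t = - r * b\<close> the quadratic term is at most half as large as
      the linear one, which forces \<open>b = 0\<close>. The summand \<open>1\<close> keeps the
      denominator positive when \<open>c = 0\<close>.\<close>
    define r where "r = 1 / (c + 1)"
    have r: "0 < r" "r * c \<le> 1" using c0 by (auto simp: r_def)
    have "2 * r * b\<^sup>2 \<le> (r * b\<^sup>2) * (r * c)"
      using q[of "- r * b"] by (simp add: power2_eq_square algebra_simps)
    also have "\<dots> \<le> (r * b\<^sup>2) * 1" using r by (intro mult_left_mono) auto
    finally have "r * b\<^sup>2 \<le> 0" by simp
    then have "b = 0" using r(1) by (simp add: mult_le_0_iff)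
    then show ?thesis by (simp add: b_def)
  qed
  have "G *v v = l *\<^sub>R v" using ort[of "G *v v - l *\<^sub>R v"] by simp
  moreover have "v \<noteq> 0" using v by auto
  ultimately show thesis using that low by blast
qed

text \<open>Eigenvectors for distinct eigenvalues are orthogonal, hence independent, so there are
  only finitely many. This finiteness gives \<open>Max\<close> and \<open>Min\<close> over singular
  values their meaning.\<close>

lemma finite_symmetric_eigenvalues:
  fixes G :: "real^'n^'n"
  assumes sym: "transpose G = G"
  shows "finite {l. \<exists>v. v \<noteq> 0 \<and> G *v v = l *\<^sub>R v}"
proof -
  define E where "E = {l. \<exists>v. v \<noteq> 0 \<and> G *v v = l *\<^sub>R v}"
  have "\<forall>l\<in>E. \<exists>v. v \<noteq> 0 \<and> G *v v = l *\<^sub>R v" by (simp add: E_def)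
  then obtain f where f: "\<And>l. l \<in> E \<Longrightarrow> f l \<noteq> 0 \<and> G *v f l = l *\<^sub>R f l"
    using bchoice[of E "\<lambda>l v. v \<noteq> 0 \<and> G *v v = l *\<^sub>R v"] by blast
  have ort: "f l \<bullet> f l' = 0" if "l \<in> E" "l' \<in> E" "l \<noteq> l'" for l l'
  proof -
    have "f l \<bullet> (G *v f l') = (G *v f l) \<bullet> f l'"
      using inner_matrix_vector_transpose[of "f l" G] sym by simp
    then show ?thesis using f[OF that(1)] f[OF that(2)] that(3) by simp
  qed
  have "pairwise orthogonal (f ` E)"
  proof (rule pairwiseI)
    fix x y assume "x \<in> f ` E" "y \<in> f ` E" "x \<noteq> y"
    then obtain l l' where "l \<in> E" "l' \<in> E" "l \<noteq> l'" "x = f l" "y = f l'"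
      by (metis (lifting) imageE)
    then show "orthogonal x y" unfolding orthogonal_def using ort by simp
  qed
  moreover have "0 \<notin> f ` E"
  proof
    assume "0 \<in> f ` E"
    then obtain l where "l \<in> E" "0 = f l" by (rule imageE)
    then show False using f[of l] by simp
  qed
  ultimately have "finite (f ` E)"
    using independent_imp_finite[OF pairwise_orthogonal_independent] by simp
  then have "finite E"
  proof (rule finite_imageD)
    show "inj_on f E"
    proof (rule inj_onI, rule ccontr)
      fix l l' assume *: "l \<in> E" "l' \<in> E" "f l = f l'" "l \<noteq> l'"
      then have "f l \<bullet> f l = 0" using ort[of l l'] by simp
      then show False using f[OF *(1)] by simp
    qed
  qed
  then show ?thesis by (simp add: E_def)
qed

section \<open>Singular values via the Gram matrix\<close>

lemma transpose_gram:
  fixes A :: "real^'n^'m"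
  shows "transpose (transpose A ** A) = transpose A ** A"
  by (simp add: matrix_transpose_mul)

lemma inner_gram:
  fixes A :: "real^'n^'m"
  shows "x \<bullet> ((transpose A ** A) *v x) = (norm (A *v x))\<^sup>2"
  by (simp add: matrix_vector_mul_assoc[symmetric] inner_matrix_vector_transpose power2_norm_eq_inner)

lemma finite_singular_values: "finite (singular_values A)"
proof -
  have "singular_values A = sqrt ` {l. \<exists>v. v \<noteq> 0 \<and> (transpose A ** A) *v v = l *\<^sub>R v}"
    by (auto simp: singular_values_def)
  then show ?thesis by (rule ssubst) (intro finite_imageI finite_symmetric_eigenvalues transpose_gram)
qed

lemma singular_valueE:
  assumes "s \<in> singular_values A"
  obtains v where "v \<noteq> 0" "norm (A *v v) = s * norm v" "s \<ge> 0"
proof -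
  obtain l v where s: "s = sqrt l" and v: "v \<noteq> 0" "(transpose A ** A) *v v = l *\<^sub>R v"
    using assms by (auto simp: singular_values_def)
  have l: "l * (norm v)\<^sup>2 = (norm (A *v v))\<^sup>2"
    using inner_gram[of v A] v by (simp add: power2_norm_eq_inner)
  then have l0: "0 \<le> l"
    using v(1) by (metis linorder_not_le mult_neg_pos zero_less_norm_iff zero_less_power zero_le_power2)
  have "(norm (A *v v))\<^sup>2 = (s * norm v)\<^sup>2" using l l0 s by (simp add: power_mult_distrib)
  then have "norm (A *v v) = s * norm v" using l0 s by (simp add: power2_eq_iff_nonneg)
  then show thesis using that v(1) l0 s by simp
qed

text \<open>The smallest eigenvalue of the negated Gram matrix is minus the largest eigenvalue of
  the Gram matrix itself. Besides the bound, this shows that the set of singular values is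
  nonempty.\<close>

lemma singular_value_bound:
  obtains s where "s \<in> singular_values A" "\<And>x. norm (A *v x) \<le> s * norm x"
proof -
  let ?G = "transpose A ** A"
  have neg: "(- ?G) *v x = - (?G *v x)" for x
    using matrix_vector_mult_diff_rdistrib[of 0 ?G x] by simp
  have "transpose (- ?G) = - transpose ?G" by (simp add: transpose_def vec_eq_iff)
  then have "transpose (- ?G) = - ?G" by (simp add: transpose_gram)
  then obtain v l where v: "v \<noteq> 0" "(- ?G) *v v = l *\<^sub>R v"
    and l: "\<And>x. l * (norm x)\<^sup>2 \<le> x \<bullet> ((- ?G) *v x)"
    using symmetric_minimal_eigenvector by blast
  have "?G *v v = (- l) *\<^sub>R v" using v(2) unfolding neg by (simp add: minus_equation_iff)
  then have sv: "sqrt (- l) \<in> singular_values A"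
    unfolding singular_values_def using v(1) by blast
  have *: "(norm (A *v x))\<^sup>2 \<le> - l * (norm x)\<^sup>2" for x
    using l[of x] unfolding neg by (simp add: inner_gram)
  have "norm (A *v x) \<le> sqrt (- l) * norm x" for x
    using real_sqrt_le_mono[OF *[of x]] by (simp only: real_sqrt_mult real_sqrt_abs abs_norm_cancel)
  then show thesis using that sv by blast
qed

lemma norm_matrix_vector_le_max_sv: "norm (A *v x) \<le> max_sv A * norm x"
proof -
  obtain s where "s \<in> singular_values A" "norm (A *v x) \<le> s * norm x"
    using singular_value_bound by blast
  moreover have "s \<le> max_sv A" if "s \<in> singular_values A" for s
    unfolding max_sv_def using that by (intro Max_ge finite_singular_values)
  ultimately show ?thesis by (meson mult_right_mono norm_ge_zero order_trans)
qed

lemma max_sv_mem: "max_sv A \<in> singular_values A"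
proof -
  obtain s where "s \<in> singular_values A" using singular_value_bound by blast
  then show ?thesis unfolding max_sv_def by (intro Max_in finite_singular_values) auto
qed

lemma max_sv_leI:
  assumes "\<And>x. norm (A *v x) \<le> c * norm x"
  shows "max_sv A \<le> c"
  using singular_valueE[OF max_sv_mem[of A]] assms
  by (metis mult_le_cancel_right_pos zero_less_norm_iff)

lemma max_sv_nonneg: "0 \<le> max_sv A"
  using singular_valueE[OF max_sv_mem[of A]] by blast

text \<open>With \<open>y = transpose A *v x\<close>, the square of \<open>norm y\<close> equals
  \<open>x \<bullet> (A *v y)\<close>; Cauchy-Schwarz and cancelling \<open>norm y\<close> finish.
  It is needed because quadratic forms of \<open>lyap\<close> evaluate at
  \<open>transpose (F i) *v v\<close>.\<close>

lemma max_sv_transpose_vector: "norm (transpose A *v x) \<le> max_sv A * norm x"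
proof (cases "transpose A *v x = 0")
  case True
  then show ?thesis by (simp add: max_sv_nonneg)
next
  case False
  let ?y = "transpose A *v x"
  have "norm ?y * norm ?y = x \<bullet> (A *v ?y)"
    by (simp add: inner_matrix_vector_transpose flip: power2_norm_eq_inner power2_eq_square)
  also have "\<dots> \<le> norm x * (max_sv A * norm ?y)"
    by (meson norm_cauchy_schwarz norm_matrix_vector_le_max_sv mult_left_mono norm_ge_zero order_trans)
  finally show ?thesis using False by (simp add: mult.assoc[symmetric] mult.commute)
qed

text \<open>The smallest eigenvalue \<open>l\<close> of \<open>G\<close> is positive and, since
  \<open>transpose G ** G\<close> has eigenvalue \<open>l\<^sup>2\<close> at the same vector, also a
  singular value; hence \<open>min_sv G \<le> l\<close>. Positivity follows because the minimum is
  attained at a vector that \<open>G\<close> does not annihilate.\<close>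

lemma min_sv_pos_def:
  assumes "pos_def G"
  shows "0 < min_sv G" and "min_sv G * (norm x)\<^sup>2 \<le> x \<bullet> (G *v x)"
proof -
  have sym: "transpose G = G" and pos: "\<And>v. v \<noteq> 0 \<Longrightarrow> v \<bullet> (G *v v) > 0"
    using assms by (auto simp: pos_def_def)
  obtain v l where v: "v \<noteq> 0" "G *v v = l *\<^sub>R v"
    and l: "\<And>x. l * (norm x)\<^sup>2 \<le> x \<bullet> (G *v x)"
    using symmetric_minimal_eigenvector[OF sym] by blast
  have "0 < l * (v \<bullet> v)" using pos[OF v(1)] v(2) by simp
  then have l0: "0 < l" using v(1) by (metis inner_gt_zero_iff zero_less_mult_pos2)
  have "(transpose G ** G) *v v = l\<^sup>2 *\<^sub>R v"
    using v(2) sym by (simp add: matrix_vector_mul_assoc[symmetric] matrix_vector_mult_scaleR power2_eq_square)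
  then have "sqrt (l\<^sup>2) \<in> singular_values G" unfolding singular_values_def using v(1) by blast
  then have mem: "l \<in> singular_values G" using l0 by simp
  then have "min_sv G \<le> l" unfolding min_sv_def by (intro Min_le finite_singular_values)
  then show "min_sv G * (norm x)\<^sup>2 \<le> x \<bullet> (G *v x)"
    using l[of x] by (meson mult_right_mono order_trans zero_le_power2)
  have "min_sv G \<in> singular_values G"
    unfolding min_sv_def using mem by (intro Min_in finite_singular_values) auto
  then obtain u where u: "u \<noteq> 0" "norm (G *v u) = min_sv G * norm u" "0 \<le> min_sv G"
    by (rule singular_valueE)
  moreover have "G *v u \<noteq> 0" using pos[OF u(1)] by auto
  ultimately have "min_sv G \<noteq> 0" by auto
  then show "0 < min_sv G" using u(3) by simp
qed

text \<open>Polarization writes \<open>4 * (x \<bullet> (V *v y))\<close> as a difference of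
  quadratic forms at \<open>x + y\<close> and \<open>x - y\<close>, and the parallelogram law
  evaluates the resulting norms. Normalizing both vectors first gives the product form of the
  bound.\<close>

lemma symmetric_inner_bound:
  fixes V :: "real^'n^'n"
  assumes sym: "transpose V = V" and bd: "\<And>x. \<bar>x \<bullet> (V *v x)\<bar> \<le> c * (norm x)\<^sup>2"
  shows "\<bar>x \<bullet> (V *v y)\<bar> \<le> c * norm x * norm y"
proof -
  have unit: "\<bar>x \<bullet> (V *v y)\<bar> \<le> c" if "norm x = 1" "norm y = 1" for x y
  proof -
    have "y \<bullet> (V *v x) = x \<bullet> (V *v y)"
      using inner_matrix_vector_transpose[of y V x] sym by (simp add: inner_commute)
    then have "4 * (x \<bullet> (V *v y)) = (x + y) \<bullet> (V *v (x + y)) - (x - y) \<bullet> (V *v (x - y))"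
      by (simp add: matrix_vector_right_distrib matrix_vector_mult_diff_distrib inner_simps)
    then have "\<bar>4 * (x \<bullet> (V *v y))\<bar> \<le> c * (norm (x + y))\<^sup>2 + c * (norm (x - y))\<^sup>2"
      using bd[of "x + y"] bd[of "x - y"] by linarith
    also have "\<dots> = c * (2 * (norm x)\<^sup>2 + 2 * (norm y)\<^sup>2)"
      by (simp add: power2_norm_eq_inner inner_simps inner_commute algebra_simps)
    finally show ?thesis using that by simp
  qed
  show ?thesis
  proof (cases "x = 0 \<or> y = 0")
    case False
    then have "\<bar>sgn x \<bullet> (V *v sgn y)\<bar> \<le> c" by (intro unit) (auto simp: norm_sgn)
    moreover have "sgn x \<bullet> (V *v sgn y) = x \<bullet> (V *v y) / (norm x * norm y)"
      by (simp add: sgn_div_norm matrix_vector_mult_scaleR field_class.field_divide_inverse mult_ac)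
    ultimately have "\<bar>x \<bullet> (V *v y)\<bar> / (norm x * norm y) \<le> c" by (simp add: abs_mult)
    then show ?thesis using False by (simp add: pos_divide_le_eq mult.assoc)
  qed auto
qed

lemma symmetric_norm_bound:
  fixes V :: "real^'n^'n"
  assumes sym: "transpose V = V" and bd: "\<And>x. \<bar>x \<bullet> (V *v x)\<bar> \<le> c * (norm x)\<^sup>2"
  shows "norm (V *v y) \<le> c * norm y"
proof (cases "V *v y = 0")
  case True
  have "0 \<le> c * (norm y)\<^sup>2" using bd[of y] by linarith
  then show ?thesis using True by (cases "y = 0") (auto simp: zero_le_mult_iff)
next
  case False
  have "norm (V *v y) * norm (V *v y) \<le> norm (V *v y) * (c * norm y)"
    using symmetric_inner_bound[OF assms, of "V *v y" y]
    by (simp add: power2_eq_square algebra_simps flip: power2_norm_eq_inner)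
  then show ?thesis using False by simp
qed

text \<open>For symmetric \<open>V\<close> the difference of two quadratic forms factors like a
  difference of squares. This is why the perturbation hypotheses below bound a product of the norms
  of a difference and a sum.\<close>

lemma symmetric_quadratic_diff_bound:
  fixes V :: "real^'n^'n"
  assumes "transpose V = V" and "\<And>x. \<bar>x \<bullet> (V *v x)\<bar> \<le> c * (norm x)\<^sup>2"
  shows "\<bar>x \<bullet> (V *v x) - y \<bullet> (V *v y)\<bar> \<le> c * norm (x - y) * norm (x + y)"
proof -
  have "x \<bullet> (V *v x) - y \<bullet> (V *v y) = (x - y) \<bullet> (V *v (x + y))"
    using inner_matrix_vector_transpose[of y V x] assms(1)
    by (simp add: matrix_vector_right_distrib inner_simps inner_commute)
  then show ?thesis using symmetric_inner_bound[OF assms] by simp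
qed

subsection \<open>The coupled Lyapunov operator\<close>

text \<open>One step of the mode-wise second moments: the moment in mode \<open>i\<close> is
  transported by \<open>F i\<close> and then handed to mode \<open>j\<close> with probability
  \<open>p i j\<close>.\<close>

definition lyap :: "('s::finite \<Rightarrow> 's \<Rightarrow> real) \<Rightarrow> ('s \<Rightarrow> real^'d^'d) \<Rightarrow> ('s \<Rightarrow> real^'d^'d) \<Rightarrow> 's \<Rightarrow> real^'d^'d" where
  "lyap p F V j = (\<Sum>i\<in>UNIV. p i j *\<^sub>R (F i ** V i ** transpose (F i)))"

lemma sum_matrix_vector_mult:
  "(\<Sum>i\<in>I. f i) *v x = (\<Sum>i\<in>I. f i *v x)" for f :: "'i \<Rightarrow> real^'n^'m"
  by (induction I rule: infinite_finite_induct) (auto simp: matrix_vector_mult_add_rdistrib)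

lemma inner_congruence:
  fixes F :: "real^'n^'m"
  shows "v \<bullet> ((F ** V ** transpose F) *v v) = (transpose F *v v) \<bullet> (V *v (transpose F *v v))"
  by (simp add: matrix_vector_mul_assoc[symmetric] inner_matrix_vector_transpose)

lemma inner_lyap:
  "v \<bullet> (lyap p F V j *v v) =
    (\<Sum>i\<in>UNIV. p i j * ((transpose (F i) *v v) \<bullet> (V i *v (transpose (F i) *v v))))"
  by (simp add: lyap_def sum_matrix_vector_mult scaleR_matrix_vector_assoc[symmetric]
      inner_sum_right inner_congruence)

lemma transpose_lyap:
  assumes "\<And>i. transpose (V i) = V i"
  shows "transpose (lyap p F V j) = lyap p F V j"
proof -
  have "transpose (lyap p F V j) = (\<Sum>i\<in>UNIV. transpose (p i j *\<^sub>R (F i ** V i ** transpose (F i))))"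
    by (simp add: lyap_def transpose_def vec_eq_iff)
  also have "\<dots> = lyap p F V j"
    by (simp add: lyap_def transpose_scalar matrix_transpose_mul assms matrix_mul_assoc)
  finally show ?thesis .
qed

lemma lyap_perturbation_bound:
  fixes F F' :: "'s::finite \<Rightarrow> real^'d^'d"
  assumes p: "\<And>i j. 0 \<le> p i j" "\<And>i j. p i j \<le> 1"
    and sym: "\<And>i. transpose (V i) = V i"
    and bd: "\<And>i x. \<bar>x \<bullet> (V i *v x)\<bar> \<le> b * (norm x)\<^sup>2"
    and diff: "\<And>i x. norm (transpose (F' i) *v x - transpose (F i) *v x)
        * norm (transpose (F' i) *v x + transpose (F i) *v x) \<le> \<epsilon> i * (norm x)\<^sup>2"
  shows "\<bar>v \<bullet> (lyap p F' V j *v v) - v \<bullet> (lyap p F V j *v v)\<bar> \<le> (\<Sum>i\<in>UNIV. \<epsilon> i) * b * (norm v)\<^sup>2"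
proof -
  have b0: "0 \<le> b"
  proof -
    obtain x :: "real^'d" where "norm x = 1" by (meson vector_choose_size zero_le_one)
    then show ?thesis using order_trans[OF abs_ge_zero bd[of x]] by simp
  qed
  let ?u = "\<lambda>i. transpose (F i) *v v" and ?u' = "\<lambda>i. transpose (F' i) *v v"
  have "v \<bullet> (lyap p F' V j *v v) - v \<bullet> (lyap p F V j *v v) =
      (\<Sum>i\<in>UNIV. p i j * (?u' i \<bullet> (V i *v ?u' i) - ?u i \<bullet> (V i *v ?u i)))"
    by (simp add: inner_lyap right_diff_distrib sum_subtractf)
  also have "\<bar>\<dots>\<bar> \<le> (\<Sum>i\<in>UNIV. b * (\<epsilon> i * (norm v)\<^sup>2))"
  proof (rule order_trans[OF sum_abs], rule sum_mono)
    fix i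
    have "\<bar>?u' i \<bullet> (V i *v ?u' i) - ?u i \<bullet> (V i *v ?u i)\<bar> \<le> b * norm (?u' i - ?u i) * norm (?u' i + ?u i)"
      using symmetric_quadratic_diff_bound[OF sym bd] .
    also have "\<dots> \<le> b * (\<epsilon> i * (norm v)\<^sup>2)"
      using mult_left_mono[OF diff b0] by (simp add: mult.assoc)
    finally have *: "\<bar>?u' i \<bullet> (V i *v ?u' i) - ?u i \<bullet> (V i *v ?u i)\<bar> \<le> b * (\<epsilon> i * (norm v)\<^sup>2)" .
    have "\<bar>p i j * (?u' i \<bullet> (V i *v ?u' i) - ?u i \<bullet> (V i *v ?u i))\<bar>
        \<le> 1 * \<bar>?u' i \<bullet> (V i *v ?u' i) - ?u i \<bullet> (V i *v ?u i)\<bar>"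
      unfolding abs_mult using p[of i j] by (intro mult_right_mono) auto
    then show "\<bar>p i j * (?u' i \<bullet> (V i *v ?u' i) - ?u i \<bullet> (V i *v ?u i))\<bar> \<le> b * (\<epsilon> i * (norm v)\<^sup>2)"
      using * unfolding mult_1_left by (rule order_trans)
  qed
  also have "\<dots> = (\<Sum>i\<in>UNIV. \<epsilon> i) * b * (norm v)\<^sup>2"
    by (simp add: sum_distrib_left sum_distrib_right mult_ac)
  finally show ?thesis .
qed

text \<open>Both bounds follow from one induction: the operator \<open>lyap p F\<close> is monotone, the perturbation of
  \<open>lyap p F'\<close> at \<open>S' n\<close> is at most \<open>2 * c * (\<Sum>i. \<epsilon> i)\<close> times the identity, and the identity is at most
  \<open>W / m\<close>, which is what \<open>S\<close> gains in each step.\<close>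
lemma lyap_iteration_perturbation:
  fixes F F' :: "'s::finite \<Rightarrow> real^'d^'d"
  assumes p: "\<And>i j. 0 \<le> p i j" "\<And>i j. p i j \<le> 1"
    and diff: "\<And>i x. norm (transpose (F' i) *v x - transpose (F i) *v x)
        * norm (transpose (F' i) *v x + transpose (F i) *v x) \<le> \<epsilon> i * (norm x)\<^sup>2"
    and W_sym: "\<And>j. transpose (W j) = W j"
    and W_ge: "\<And>j v. m * (norm v)\<^sup>2 \<le> v \<bullet> (W j *v v)" and m: "0 < m"
    and S_0: "\<And>j. S 0 j = 0" and S_Suc: "\<And>n j. S (Suc n) j = W j + lyap p F (S n) j"
    and S'_0: "\<And>j. S' 0 j = 0" and S'_Suc: "\<And>n j. S' (Suc n) j = W j + lyap p F' (S' n) j"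
    and S_le: "\<And>n j v. v \<bullet> (S n j *v v) \<le> c * (norm v)\<^sup>2"
    and small: "2 * c * (\<Sum>i\<in>UNIV. \<epsilon> i) \<le> m"
  shows "\<bar>v \<bullet> (S' n j *v v) - v \<bullet> (S n j *v v)\<bar> \<le> 2 * c * (\<Sum>i\<in>UNIV. \<epsilon> i) / m * (v \<bullet> (S n j *v v))"
    and "\<bar>v \<bullet> (S' n j *v v)\<bar> \<le> 2 * c * (norm v)\<^sup>2"
proof -
  define e where "e = (\<Sum>i\<in>UNIV. \<epsilon> i)"
  define r where "r = 2 * c * e / m"
  have r1: "r \<le> 1" using small m by (simp add: r_def e_def)
  obtain x :: "real^'d" where x: "norm x = 1" by (meson vector_choose_size zero_le_one)
  have e0: "0 \<le> e"
    unfolding e_def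
  proof (rule sum_nonneg)
    fix i
    have "0 \<le> \<epsilon> i * (norm x)\<^sup>2"
      using diff[of i x] by (rule order_trans[rotated]) simp
    then show "0 \<le> \<epsilon> i" using x by simp
  qed
  have "0 \<le> c" using S_le[of x 0] x by (simp add: S_0)
  then have r0: "0 \<le> r" using e0 m by (simp add: r_def)
  \<comment> \<open>Symmetry of \<open>S' n\<close> is what \<open>lyap_perturbation_bound\<close>
    requires of its argument.\<close>
  have sym: "transpose (S' n j) = S' n j" for n j
  proof (induction n arbitrary: j)
    case 0 show ?case by (simp add: S'_0 transpose_def vec_eq_iff)
  next
    case (Suc n)
    have "transpose (W j + lyap p F' (S' n) j) = transpose (W j) + transpose (lyap p F' (S' n) j)"
      by (simp add: transpose_def vec_eq_iff)
    then show ?case by (simp add: S'_Suc W_sym transpose_lyap Suc.IH)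
  qed
  have nonneg: "0 \<le> v \<bullet> (S n j *v v)" for n j v
  proof (induction n arbitrary: j v)
    case 0 show ?case by (simp add: S_0)
  next
    case (Suc n)
    have "0 \<le> m * (norm v)\<^sup>2" using m by simp
    also have "\<dots> \<le> v \<bullet> (W j *v v)" by (rule W_ge)
    finally show ?case
      by (simp add: S_Suc matrix_vector_mult_add_rdistrib inner_add_right inner_lyap
          sum_nonneg p(1) Suc.IH)
  qed
  have diffS: "\<bar>v \<bullet> (S' n j *v v) - v \<bullet> (S n j *v v)\<bar> \<le> r * (v \<bullet> (S n j *v v))" for n j v
  proof (induction n arbitrary: j v)
    case 0 show ?case by (simp add: S_0 S'_0)
  next
    case (Suc n)
    \<comment> \<open>As \<open>r \<le> 1\<close>, the induction hypothesis places the form of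
      \<open>S' n\<close> within twice that of \<open>S n\<close>, so the a priori bound on
      \<open>S' n\<close> comes out of the same induction.\<close>
    have bd: "\<bar>x \<bullet> (S' n i *v x)\<bar> \<le> 2 * c * (norm x)\<^sup>2" for i x
    proof -
      have "r * (x \<bullet> (S n i *v x)) \<le> x \<bullet> (S n i *v x)"
        using mult_right_mono[OF r1 nonneg] by simp
      then show ?thesis using Suc.IH[of x i] S_le[of x n i] nonneg[of x n i] by linarith
    qed
    let ?u = "\<lambda>i. transpose (F i) *v v"
    let ?L = "v \<bullet> (lyap p F (S n) j *v v)" and ?L' = "v \<bullet> (lyap p F (S' n) j *v v)"
    have 1: "\<bar>v \<bullet> (lyap p F' (S' n) j *v v) - ?L'\<bar> \<le> e * (2 * c) * (norm v)\<^sup>2"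
      unfolding e_def by (rule lyap_perturbation_bound[OF p sym bd diff])
    have "?L' - ?L = (\<Sum>i\<in>UNIV. p i j * (?u i \<bullet> (S' n i *v ?u i) - ?u i \<bullet> (S n i *v ?u i)))"
      by (simp add: inner_lyap right_diff_distrib sum_subtractf)
    also have "\<bar>\<dots>\<bar> \<le> (\<Sum>i\<in>UNIV. p i j * (r * (?u i \<bullet> (S n i *v ?u i))))"
    proof (rule order_trans[OF sum_abs], rule sum_mono)
      fix i show "\<bar>p i j * (?u i \<bullet> (S' n i *v ?u i) - ?u i \<bullet> (S n i *v ?u i))\<bar>
          \<le> p i j * (r * (?u i \<bullet> (S n i *v ?u i)))"
        unfolding abs_mult using Suc.IH p(1)[of i j] by (simp add: mult_left_mono)
    qed
    also have "\<dots> = r * ?L" by (simp add: inner_lyap sum_distrib_left mult_ac)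
    finally have 2: "\<bar>?L' - ?L\<bar> \<le> r * ?L" .
    \<comment> \<open>The constant \<open>r\<close> is chosen for this identity: the perturbation
      error equals \<open>r * m\<close> times the squared norm and is absorbed by the term
      \<open>W j\<close>.\<close>
    have "e * (2 * c) * (norm v)\<^sup>2 = r * (m * (norm v)\<^sup>2)" using m by (simp add: r_def)
    also have "\<dots> \<le> r * (v \<bullet> (W j *v v))" using W_ge r0 by (rule mult_left_mono)
    finally have 3: "e * (2 * c) * (norm v)\<^sup>2 \<le> r * (v \<bullet> (W j *v v))" .
    have "v \<bullet> (S' (Suc n) j *v v) = v \<bullet> (W j *v v) + v \<bullet> (lyap p F' (S' n) j *v v)"
      "v \<bullet> (S (Suc n) j *v v) = v \<bullet> (W j *v v) + ?L"
      by (simp_all add: S_Suc S'_Suc matrix_vector_mult_add_rdistrib inner_add_right)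
    then show ?case using 1 2 3 by (simp add: distrib_left)
  qed
  then show "\<bar>v \<bullet> (S' n j *v v) - v \<bullet> (S n j *v v)\<bar> \<le> 2 * c * (\<Sum>i\<in>UNIV. \<epsilon> i) / m * (v \<bullet> (S n j *v v))"
    by (simp add: r_def e_def)
  have "r * (v \<bullet> (S n j *v v)) \<le> v \<bullet> (S n j *v v)"
    using mult_right_mono[OF r1 nonneg] by simp
  then show "\<bar>v \<bullet> (S' n j *v v)\<bar> \<le> 2 * c * (norm v)\<^sup>2"
    using diffS[of v n j] S_le[of v n j] nonneg[of v n j] by linarith
qed

text \<open>The trace of a positive semidefinite matrix dominates each of its entries, and the
  traces form a nonnegative series with bounded partial sums.\<close>

lemma summable_psd_matrix:
  fixes X :: "nat \<Rightarrow> real^'n^'n"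
  assumes sym: "\<And>t. transpose (X t) = X t" and psd: "\<And>t v. 0 \<le> v \<bullet> (X t *v v)"
    and bd: "\<And>n v. v \<bullet> ((\<Sum>t<n. X t) *v v) \<le> c * (norm v)\<^sup>2"
  shows "summable X"
proof (rule summable_comparison_test)
  define b where "b t = (\<Sum>i\<in>UNIV. axis i 1 \<bullet> (X t *v axis i 1))" for t
  have entry: "X t $ i $ j = axis i 1 \<bullet> (X t *v axis j 1)" for t i j
    by (simp add: inner_axis' matrix_vector_mul_component matrix_vector_mult_basis column_def)
  have bound: "\<bar>X t $ i $ j\<bar> \<le> b t" for t i j
  proof -
    have le_b: "X t $ i $ i \<le> b t" for i
      unfolding b_def entry by (rule member_le_sum) (auto simp: psd)
    have sy: "X t $ j $ i = X t $ i $ j" using sym[of t] by (metis transpose_def vec_lambda_beta)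
    \<comment> \<open>With \<open>s = 1\<close> and \<open>s = -1\<close>, nonnegativity bounds
      twice the absolute value of the off-diagonal entry by the sum of the two diagonal
      entries.\<close>
    have ex: "(axis i 1 + s *\<^sub>R axis j 1) \<bullet> (X t *v (axis i 1 + s *\<^sub>R axis j 1))
        = X t $ i $ i + s * X t $ i $ j + s * X t $ j $ i + s * s * X t $ j $ j" for s
      unfolding entry by (simp add: matrix_vector_right_distrib matrix_vector_mult_scaleR inner_simps algebra_simps)
    show ?thesis
      using psd[of "axis i 1 + 1 *\<^sub>R axis j 1" t, unfolded ex] psd[of "axis i 1 + (-1) *\<^sub>R axis j 1" t, unfolded ex]
        le_b[of i] le_b[of j] sy by simp
  qed
  have "norm (X t) \<le> (\<Sum>i\<in>(UNIV::'n set). \<Sum>j\<in>(UNIV::'n set). b t)" for t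
  proof -
    have "norm (X t) \<le> (\<Sum>i\<in>UNIV. norm (X t $ i))"
      unfolding norm_vec_def by (rule L2_set_le_sum) simp
    also have "\<dots> \<le> (\<Sum>i\<in>(UNIV::'n set). \<Sum>j\<in>(UNIV::'n set). b t)"
      by (intro sum_mono order_trans[OF norm_le_l1_cart] bound)
    finally show ?thesis .
  qed
  then show "\<exists>N. \<forall>n\<ge>N. norm (X n) \<le> (\<Sum>i\<in>(UNIV::'n set). \<Sum>j\<in>(UNIV::'n set). b n)" by blast
  have "summable b"
  proof (rule summableI_nonneg_bounded)
    show "0 \<le> b t" for t unfolding b_def by (intro sum_nonneg psd)
    show "(\<Sum>t<n. b t) \<le> (\<Sum>i\<in>(UNIV::'n set). c)" for n
    proof -
      have "(\<Sum>t<n. b t) = (\<Sum>i\<in>UNIV. axis i 1 \<bullet> ((\<Sum>t<n. X t) *v axis i 1))"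
        unfolding b_def sum_matrix_vector_mult inner_sum_right by (rule sum.swap)
      also have "\<dots> \<le> (\<Sum>i\<in>(UNIV::'n set). c)"
        by (intro sum_mono order_trans[OF bd]) simp
      finally show ?thesis .
    qed
  qed
  then show "summable (\<lambda>t. \<Sum>i\<in>(UNIV::'n set). \<Sum>j\<in>(UNIV::'n set). b t)"
    by (intro summable_sum)
qed

text \<open>Grouping coordinates by mode splits the squared norm into a sum over blocks, and each
  block is acted on by its own \<open>V i\<close>.\<close>

lemma norm_block_diag_le:
  fixes V :: "'s::finite \<Rightarrow> real^'d^'d"
  assumes bd: "\<And>i v. norm (V i *v v) \<le> c * norm v" and c: "0 \<le> c"
  shows "norm (block_diag V *v x) \<le> c * norm x"
proof -
  have sq: "(norm x)\<^sup>2 = (\<Sum>i\<in>UNIV. (norm (\<chi> a. x $ (i, a)))\<^sup>2)" for x :: "real^('s \<times> 'd)"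
    by (simp add: power2_norm_eq_inner inner_vec_def sum.cartesian_product)
  have comp: "(\<chi> a. (block_diag V *v x) $ (i, a)) = V i *v (\<chi> a. x $ (i, a))" for i
  proof -
    have "(block_diag V *v x) $ (i, a) = (\<Sum>b\<in>UNIV. V i $ a $ b * x $ (i, b))" for a
    proof -
      have "(block_diag V *v x) $ (i, a) =
          (\<Sum>k\<in>UNIV. \<Sum>b\<in>UNIV. (if i = k then V i $ a $ b else 0) * x $ (k, b))"
        by (simp add: matrix_vector_mult_def block_diag_def sum.cartesian_product case_prod_unfold cong: if_cong)
      also have "\<dots> = (\<Sum>k\<in>UNIV. if i = k then \<Sum>b\<in>UNIV. V i $ a $ b * x $ (k, b) else 0)"
        by (intro sum.cong) auto
      finally show ?thesis by simp
    qed
    then show ?thesis by (simp add: matrix_vector_mult_def vec_eq_iff)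
  qed
  have "(norm (block_diag V *v x))\<^sup>2 \<le> (\<Sum>i\<in>UNIV. (c * norm (\<chi> a. x $ (i, a)))\<^sup>2)"
    unfolding sq[of "block_diag V *v x"] comp by (intro sum_mono power_mono bd) simp
  also have "\<dots> = (c * norm x)\<^sup>2"
    by (simp add: power_mult_distrib sq[of x] sum_distrib_left)
  finally show ?thesis by (rule power2_le_imp_le) (simp add: c)
qed

subsection \<open>Second moments of the state\<close>

lemma matrix_mult_scaleR:
  fixes A :: "real^'n^'m" and B :: "real^'p^'n"
  shows "(r *\<^sub>R A) ** B = r *\<^sub>R (A ** B)" "A ** (r *\<^sub>R B) = r *\<^sub>R (A ** B)"
  by (simp_all add: matrix_matrix_mult_def vec_eq_iff sum_distrib_left mult_ac)

lemma matrix_add_rdistrib: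
  fixes A B :: "real^'n^'m" and C :: "real^'p^'n"
  shows "(A + B) ** C = A ** C + B ** C"
  by (simp add: matrix_matrix_mult_def vec_eq_iff distrib_right sum.distrib)

text \<open>The ordered product of closed-loop matrices along a mode sequence. It separates the
  dependence on the path from the dependence on the initial state, and at time \<open>t\<close> it
  only involves the modes before \<open>t\<close>.\<close>

primrec transition :: "('s \<Rightarrow> real^'d^'d) \<Rightarrow> (nat \<Rightarrow> 's) \<Rightarrow> nat \<Rightarrow> real^'d^'d" where
  "transition F s 0 = mat 1"
| "transition F s (Suc t) = F (s t) ** transition F s t"

lemma traj_eq_transition:
  "traj A B K s v t = transition (\<lambda>i. A i - B i ** K i) s t *v v"
proof (induction t)
  case (Suc t)
  have neg: "M *v (- x) = - (M *v x)" for M :: "real^'n^'m" and x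
    using matrix_vector_mult_diff_distrib[of M 0 x] by simp
  show ?case
    by (simp add: Suc.IH neg matrix_vector_mult_diff_rdistrib flip: matrix_vector_mul_assoc)
qed simp

lemma transition_cong:
  "(\<And>k. k < t \<Longrightarrow> s k = s' k) \<Longrightarrow> transition F s t = transition F s' t"
  by (induction t) auto

lemma outer_square_matrix_vector:
  "outer_square (P *v x) = P ** outer_square x ** transpose P"
proof -
  have "(P ** outer_square x) $ i $ k = (P *v x) $ i * x $ k" for i k
    by (simp add: outer_square_def matrix_matrix_mult_def matrix_vector_mult_def sum_distrib_left mult_ac)
  then have "(P ** outer_square x ** transpose P) $ i $ j = (\<Sum>k\<in>UNIV. (P *v x) $ i * x $ k * P $ j $ k)" for i j
    by (simp add: matrix_matrix_mult_def[of "P ** outer_square x"] transpose_def)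
  moreover have "(\<Sum>k\<in>UNIV. (P *v x) $ i * x $ k * P $ j $ k) = (P *v x) $ i * (\<Sum>k\<in>UNIV. P $ j $ k * x $ k)" for i j
    by (simp only: sum_distrib_left mult_ac)
  moreover have "(\<Sum>k\<in>UNIV. P $ j $ k * x $ k) = (P *v x) $ j" for j
    by (simp add: matrix_vector_mult_def)
  ultimately have "(P ** outer_square x ** transpose P) $ i $ j = (P *v x) $ i * (P *v x) $ j" for i j
    by simp
  then show ?thesis by (simp add: outer_square_def vec_eq_iff)
qed

lemma transpose_outer_square: "transpose (outer_square x) = outer_square x"
  by (simp add: outer_square_def transpose_def vec_eq_iff mult.commute)

lemma inner_outer_square: "v \<bullet> (outer_square x *v v) = (v \<bullet> x)\<^sup>2"
  by (simp add: outer_square_def matrix_vector_mult_def inner_vec_def power2_eq_square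
      sum_product sum_distrib_left mult_ac)

lemma bounded_linear_congruence:
  fixes P :: "real^'n^'m"
  shows "bounded_linear (\<lambda>X. P ** X ** transpose P)"
  by (intro linear_conv_bounded_linear[THEN iffD1] linearI)
    (simp_all add: matrix_add_ldistrib matrix_add_rdistrib matrix_mult_scaleR)

lemma bounded_linear_quadratic_form:
  fixes v :: "real^'n"
  shows "bounded_linear (\<lambda>X. v \<bullet> (X *v v))"
  by (intro linear_conv_bounded_linear[THEN iffD1] linearI)
    (simp_all add: matrix_vector_mult_add_rdistrib inner_add_right flip: scaleR_matrix_vector_assoc)

lemma bounded_linear_transpose: "bounded_linear (transpose :: real^'n^'m \<Rightarrow> _)"
  by (intro linear_conv_bounded_linear[THEN iffD1] linearI)
    (simp_all add: transpose_def vec_eq_iff)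

lemma bounded_linear_entry: "bounded_linear (\<lambda>X::real^'n^'m. X $ a $ b)"
  by (intro linear_conv_bounded_linear[THEN iffD1] linearI) simp_all

context mjls
begin

section \<open>Independence of the initial state and the mode path\<close>

lemma mode_measurable [measurable]: "\<omega> t \<in> measurable M (count_space UNIV)"
  using chain by (auto simp: markov_chain_def)

lemma x0_borel [measurable]: "x0 \<in> borel_measurable M" by (rule x0_measurable)

definition path_space :: "(nat \<Rightarrow> 's) measure" where
  "path_space = PiM UNIV (\<lambda>t. count_space UNIV)"

lemma path_measurable [measurable]: "(\<lambda>w t. \<omega> t w) \<in> measurable M path_space"
  unfolding path_space_def by (rule measurable_PiM_single') auto

text \<open>Independence is assumed for the sigma-algebras generated by \<open>x0\<close> and by the
  whole path. Measurable functions of either generate smaller sigma-algebras, to which it is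
  inherited.\<close>

lemma indep_x0_path:
  assumes f: "f \<in> borel_measurable borel" and g: "g \<in> borel_measurable path_space"
  shows "indep_var borel (\<lambda>w. f (x0 w) :: real) borel (\<lambda>w. g (\<lambda>t. \<omega> t w))"
proof -
  have sub: "sigma_sets (space M) {(\<lambda>w. h (X w)) -` S \<inter> space M | S. S \<in> sets borel} \<subseteq>
      sets (vimage_algebra (space M) X N)" if "X \<in> measurable M N" "h \<in> borel_measurable N"
    for X :: "'w \<Rightarrow> 'z" and N and h :: "'z \<Rightarrow> real"
  proof -
    have "(\<lambda>w. h (X w)) \<in> borel_measurable (vimage_algebra (space M) X N)"
      by (rule measurable_compose[OF measurable_vimage_algebra1 that(2)])
        (use measurable_space[OF that(1)] in auto)
    then have "{(\<lambda>w. h (X w)) -` S \<inter> space M | S. S \<in> sets borel} \<subseteq> sets (vimage_algebra (space M) X N)"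
      using measurable_sets[of "\<lambda>w. h (X w)" "vimage_algebra (space M) X N" borel] by auto
    then show ?thesis using sets.sigma_sets_subset[of _ "vimage_algebra (space M) X N"] by simp
  qed
  have "indep_set (sigma_sets (space M) {(\<lambda>w. f (x0 w)) -` S \<inter> space M | S. S \<in> sets borel})
      (sigma_sets (space M) {(\<lambda>w. g (\<lambda>t. \<omega> t w)) -` S \<inter> space M | S. S \<in> sets borel})"
    using x0_indep unfolding indep_set_def path_space_def[symmetric]
    by (rule indep_sets_mono_sets)
      (auto split: bool.splits dest: subsetD[OF sub[OF x0_borel f]] subsetD[OF sub[OF path_measurable g]])
  moreover have "(\<lambda>w. f (x0 w)) \<in> borel_measurable M" using f by measurable
  moreover have "(\<lambda>w. g (\<lambda>t. \<omega> t w)) \<in> borel_measurable M"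
    using measurable_compose[OF path_measurable g] .
  ultimately show ?thesis unfolding indep_var_eq by blast
qed

lemma integrable_outer_x0: "integrable M (\<lambda>w. outer_square (x0 w))"
  and second_moment_eq: "second_moment D = (\<integral>w. outer_square (x0 w) \<partial>M)"
proof -
  have meas: "outer_square \<in> borel_measurable (borel :: (real^'d) measure)"
    using borel_measurable_integrable[OF second_moment_integrable]
    by (simp add: x0_distr[symmetric])
  show "integrable M (\<lambda>w. outer_square (x0 w))"
    using second_moment_integrable meas
    by (simp add: x0_distr[symmetric] integrable_distr_eq)
  show "second_moment D = (\<integral>w. outer_square (x0 w) \<partial>M)"
    using meas by (simp add: second_moment_def x0_distr[symmetric] integral_distr)
qed

text \<open>The indicator depends on the path and the outer square on \<open>x0\<close>, so the
  expectation factorizes. The fixed matrix \<open>P\<close> leaves the integral as a bounded linear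
  map.\<close>

lemma
  assumes E: "E \<in> sets path_space"
  shows integrable_event_outer:
    "integrable M (\<lambda>w. indicator E (\<lambda>t. \<omega> t w) *\<^sub>R outer_square (P *v x0 w))"
    and integral_event_outer:
    "(\<integral>w. indicator E (\<lambda>t. \<omega> t w) *\<^sub>R outer_square (P *v x0 w) \<partial>M) =
       prob {w \<in> space M. (\<lambda>t. \<omega> t w) \<in> E} *\<^sub>R (P ** second_moment D ** transpose P)"
proof -
  let ?E = "{w \<in> space M. (\<lambda>t. \<omega> t w) \<in> E}"
  let ?I = "\<lambda>w. indicator E (\<lambda>t. \<omega> t w) :: real"
  have Em: "?E \<in> events" using E by measurable
  have ind: "?I w = indicator ?E w" if "w \<in> space M" for w
    using that by (simp add: indicator_def)
  have int: "integrable M (\<lambda>w. ?I w *\<^sub>R outer_square (x0 w))"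
    using integrable_mult_indicator[OF Em integrable_outer_x0]
    by (simp cong: Bochner_Integration.integrable_cong add: ind)
  have val: "(\<integral>w. ?I w *\<^sub>R outer_square (x0 w) \<partial>M) = prob ?E *\<^sub>R second_moment D"
  proof -
    \<comment> \<open>Comparing entries makes both factors real random variables, to which the
      product rule for independent variables applies.\<close>
    have "(\<integral>w. ?I w *\<^sub>R outer_square (x0 w) \<partial>M) $ a $ b = (prob ?E *\<^sub>R second_moment D) $ a $ b" for a b
    proof -
      let ?h = "\<lambda>x::real^'d. x $ a * x $ b"
      have h: "outer_square x $ a $ b = ?h x" for x :: "real^'d" by (simp add: outer_square_def)
      have iv: "indep_var borel (\<lambda>w. ?h (x0 w)) borel ?I"
        by (rule indep_x0_path) (use E in measurable)
      have hi: "integrable M (\<lambda>w. ?h (x0 w))"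
        using integrable_bounded_linear[OF bounded_linear_entry integrable_outer_x0, of a b]
        by (simp add: h)
      have Ii: "integrable M ?I"
      proof -
        have "integrable M (indicator ?E :: _ \<Rightarrow> real)" using Em by (intro integrable_real_indicator) (simp_all add: emeasure_eq_measure)
        then show ?thesis by (simp cong: Bochner_Integration.integrable_cong add: ind)
      qed
      have "(\<integral>w. ?I w *\<^sub>R outer_square (x0 w) \<partial>M) $ a $ b = (\<integral>w. ?h (x0 w) * ?I w \<partial>M)"
        using integral_bounded_linear[OF bounded_linear_entry int, of a b]
        by (simp add: h mult.commute)
      also have "\<dots> = (\<integral>w. ?h (x0 w) \<partial>M) * (\<integral>w. ?I w \<partial>M)"
        by (rule indep_var_lebesgue_integral[OF iv hi Ii])
      also have "(\<integral>w. ?h (x0 w) \<partial>M) = second_moment D $ a $ b"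
        using integral_bounded_linear[OF bounded_linear_entry integrable_outer_x0, of a b]
        by (simp add: second_moment_eq h)
      also have "(\<integral>w. ?I w \<partial>M) = prob ?E"
      proof -
        have "(\<integral>w. ?I w \<partial>M) = (\<integral>w. indicator ?E w \<partial>M)"
          by (rule Bochner_Integration.integral_cong) (simp_all add: ind)
        then show ?thesis using Em by simp
      qed
      finally show ?thesis by simp
    qed
    then show ?thesis by (simp add: vec_eq_iff)
  qed
  have eq: "?I w *\<^sub>R outer_square (P *v x0 w) = P ** (?I w *\<^sub>R outer_square (x0 w)) ** transpose P" for w
    by (simp add: outer_square_matrix_vector matrix_mult_scaleR)
  show "integrable M (\<lambda>w. ?I w *\<^sub>R outer_square (P *v x0 w))"
    unfolding eq by (rule integrable_bounded_linear[OF bounded_linear_congruence int])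
  have "(\<integral>w. ?I w *\<^sub>R outer_square (P *v x0 w) \<partial>M) = P ** (prob ?E *\<^sub>R second_moment D) ** transpose P"
    unfolding eq val[symmetric] by (rule integral_bounded_linear[OF bounded_linear_congruence int])
  then show "(\<integral>w. ?I w *\<^sub>R outer_square (P *v x0 w) \<partial>M) = prob ?E *\<^sub>R (P ** second_moment D ** transpose P)"
    by (simp add: matrix_mult_scaleR)
qed

section \<open>Expansion over finite mode paths\<close>

definition paths :: "nat \<Rightarrow> (nat \<Rightarrow> 's) set" where
  "paths t = (PiE {..t} (\<lambda>_. UNIV))"

lemma finite_paths: "finite (paths t)"
  unfolding paths_def by (intro finite_PiE) auto

text \<open>Paths in \<open>paths t\<close> are extensional on \<open>{..t}\<close>, so exactly one
  of them, the restriction of \<open>r\<close>, agrees with \<open>r\<close> up to time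
  \<open>t\<close>; the sum picks out its term.\<close>

lemma sum_paths:
  fixes h :: "(nat \<Rightarrow> 's) \<Rightarrow> 'e::real_vector"
  shows "(\<Sum>s\<in>paths t. indicator {r. \<forall>k\<le>t. r k = s k} r *\<^sub>R h s) = h (restrict r {..t})"
proof -
  have mem: "restrict r {..t} \<in> paths t" by (auto simp: paths_def)
  have "indicator {r. \<forall>k\<le>t. r k = s k} r *\<^sub>R h s = (if s = restrict r {..t} then h s else 0)"
    if "s \<in> paths t" for s
  proof -
    have "(\<forall>k\<le>t. r k = s k) \<longleftrightarrow> s = restrict r {..t}"
      using that by (auto simp: paths_def PiE_def extensional_def fun_eq_iff)
    then show ?thesis by (simp add: indicator_def)
  qed
  then have "(\<Sum>s\<in>paths t. indicator {r. \<forall>k\<le>t. r k = s k} r *\<^sub>R h s)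
      = (\<Sum>s\<in>paths t. if s = restrict r {..t} then h s else 0)"
    by (rule sum.cong[OF refl])
  then show ?thesis using mem by (simp add: finite_paths)
qed

lemma initial_segment_sets: "{r. \<forall>k\<le>t. r k = s k} \<in> sets path_space"
  and mode_sets: "{r. r t = i} \<in> sets path_space"
proof -
  have *: "{r. r t = i} \<in> sets path_space" for t i
  proof -
    have "(\<lambda>r. r t) -` {i} \<inter> space path_space \<in> sets path_space"
      unfolding path_space_def by (intro measurable_sets[OF measurable_component_singleton]) auto
    moreover have "(\<lambda>r. r t) -` {i} \<inter> space path_space = {r. r t = i}"
      by (auto simp: path_space_def space_PiM)
    ultimately show ?thesis by simp
  qed
  then show "{r. r t = i} \<in> sets path_space" .
  have "{r. \<forall>k\<le>t. r k = s k} = (\<Inter>k\<in>{..t}. {r. r k = s k})" by auto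
  then show "{r. \<forall>k\<le>t. r k = s k} \<in> sets path_space" using * by (auto intro!: sets.finite_INT)
qed

definition path_prob :: "nat \<Rightarrow> (nat \<Rightarrow> 's) \<Rightarrow> real" where
  "path_prob t s = prob {w \<in> space M. \<forall>k\<le>t. \<omega> k w = s k}"

text \<open>The Markov property speaks only about histories of positive probability. For a null
  history both sides vanish by monotonicity.\<close>

lemma path_prob_step:
  "prob {w \<in> space M. (\<forall>k\<le>t. \<omega> k w = s k) \<and> \<omega> (Suc t) w = j} = path_prob t s * p (s t) j"
proof (cases "path_prob t s > 0")
  case True
  then have "\<P>(w in M. \<omega> (Suc t) w = j \<bar> \<forall>k\<le>t. \<omega> k w = s k) = p (s t) j"
    using chain by (auto simp: markov_chain_def path_prob_def)
  moreover have "{w \<in> space M. \<omega> (Suc t) w = j \<and> (\<forall>k\<le>t. \<omega> k w = s k)} =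
      {w \<in> space M. (\<forall>k\<le>t. \<omega> k w = s k) \<and> \<omega> (Suc t) w = j}" by auto
  ultimately show ?thesis using True
    by (simp add: cond_prob_def path_prob_def divide_eq_eq mult.commute)
next
  case False
  then have 0: "path_prob t s = 0" using measure_nonneg by (simp add: path_prob_def order_less_le)
  have ev: "{w \<in> space M. \<forall>k\<le>t. \<omega> k w = s k} \<in> events"
    using measurable_sets[OF path_measurable initial_segment_sets[of t s]]
    by (simp add: vimage_def Int_def conj_commute)
  have "prob {w \<in> space M. (\<forall>k\<le>t. \<omega> k w = s k) \<and> \<omega> (Suc t) w = j} \<le> path_prob t s"
    unfolding path_prob_def by (rule finite_measure_mono[OF _ ev]) auto
  then show ?thesis using 0 measure_nonneg by (simp add: order_antisym)
qed

section \<open>Second-moment recursion for a fixed policy\<close>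

context
  fixes K :: "'s \<Rightarrow> real^'d^'k"
begin

definition closed_loop :: "'s \<Rightarrow> real^'d^'d" where
  "closed_loop i = A i - B i ** K i"

definition state :: "nat \<Rightarrow> 'w \<Rightarrow> real^'d" where
  "state t w = traj A B K (\<lambda>n. \<omega> n w) (x0 w) t"

lemma state_eq: "state t w = transition closed_loop (\<lambda>n. \<omega> n w) t *v x0 w"
  by (simp add: state_def traj_eq_transition closed_loop_def[abs_def])

text \<open>On the event that the first modes follow \<open>s\<close>, the transition matrix is
  constant. Its expectation thus reduces to finitely many terms of the form treated by
  \<open>integral_event_outer\<close>.\<close>

lemma mode_outer_state_eq:
  "indicator {w. \<omega> t w = i} w *\<^sub>R outer_square (state t w) =
    (\<Sum>s\<in>paths t. (if s t = i then 1 else 0) *\<^sub>R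
      (indicator {r. \<forall>k\<le>t. r k = s k} (\<lambda>n. \<omega> n w) *\<^sub>R outer_square (transition closed_loop s t *v x0 w)))"
proof -
  have "transition closed_loop (restrict (\<lambda>n. \<omega> n w) {..t}) t = transition closed_loop (\<lambda>n. \<omega> n w) t"
    by (rule transition_cong) simp
  then show ?thesis
    using sum_paths[of t "\<lambda>n. \<omega> n w" "\<lambda>s. (if s t = i then 1 else 0) *\<^sub>R outer_square (transition closed_loop s t *v x0 w)"]
    by (simp add: state_eq indicator_def mult.commute)
qed

lemma integrable_mode_outer_state:
  "integrable M (\<lambda>w. indicator {w. \<omega> t w = i} w *\<^sub>R outer_square (state t w))"
  unfolding mode_outer_state_eq
  by (intro Bochner_Integration.integrable_sum integrable_scaleR_right integrable_event_outer initial_segment_sets)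

lemma mode_corr_eq_sum_paths:
  "mode_corr M \<omega> x0 A B K i t =
    (\<Sum>s\<in>paths t. (if s t = i then 1 else 0) *\<^sub>R (path_prob t s *\<^sub>R
      (transition closed_loop s t ** second_moment D ** transpose (transition closed_loop s t))))"
proof -
  have "mode_corr M \<omega> x0 A B K i t =
      (\<integral>w. indicator {w. \<omega> t w = i} w *\<^sub>R outer_square (state t w) \<partial>M)"
    by (simp add: mode_corr_def state_def)
  also have "\<dots> = (\<Sum>s\<in>paths t. (if s t = i then 1 else 0) *\<^sub>R
      (\<integral>w. indicator {r. \<forall>k\<le>t. r k = s k} (\<lambda>n. \<omega> n w) *\<^sub>R outer_square (transition closed_loop s t *v x0 w) \<partial>M))"
    unfolding mode_outer_state_eq
    by (subst Bochner_Integration.integral_sum)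
      (intro integrable_scaleR_right integrable_event_outer initial_segment_sets,
       intro sum.cong refl integral_scaleR_right integrable_event_outer initial_segment_sets)
  finally show ?thesis
    by (simp only: integral_event_outer[OF initial_segment_sets] path_prob_def mem_Collect_eq)
qed

lemma mode_corr_0: "mode_corr M \<omega> x0 A B K i 0 = \<pi> i *\<^sub>R second_moment D"
proof -
  have "mode_corr M \<omega> x0 A B K i 0 =
      (\<integral>w. indicator {r. r 0 = i} (\<lambda>n. \<omega> n w) *\<^sub>R outer_square (mat 1 *v x0 w) \<partial>M)"
    by (simp add: mode_corr_def indicator_def)
  also have "\<dots> = prob {w \<in> space M. \<omega> 0 w = i} *\<^sub>R second_moment D"
    unfolding integral_event_outer[OF mode_sets] by simp
  finally show ?thesis using chain by (simp add: markov_chain_def)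
qed

text \<open>The state at time \<open>Suc t\<close> depends on the modes up to \<open>t\<close> only,
  so the mode at \<open>Suc t\<close> enters solely through its indicator. Summing over paths up to
  \<open>t\<close>, the Markov property contributes the factor \<open>p (s t) j\<close>.\<close>

lemma mode_corr_Suc:
  "mode_corr M \<omega> x0 A B K j (Suc t) = lyap p closed_loop (\<lambda>i. mode_corr M \<omega> x0 A B K i t) j"
proof -
  let ?P = "\<lambda>s. closed_loop (s t) ** transition closed_loop s t"
  let ?E = "\<lambda>s. {r. (\<forall>k\<le>t. r k = s k) \<and> r (Suc t) = j}"
  have E: "?E s \<in> sets path_space" for s
    using sets.Int[OF initial_segment_sets[of t s] mode_sets[of "Suc t" j]] by (simp add: Int_def)
  have pt: "indicator {w. \<omega> (Suc t) w = j} w *\<^sub>R outer_square (state (Suc t) w) =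
    (\<Sum>s\<in>paths t. indicator (?E s) (\<lambda>n. \<omega> n w) *\<^sub>R outer_square (?P s *v x0 w))" for w
  proof -
    have "transition closed_loop (restrict (\<lambda>n. \<omega> n w) {..t}) t = transition closed_loop (\<lambda>n. \<omega> n w) t"
      by (rule transition_cong) simp
    then have "indicator {w. \<omega> (Suc t) w = j} w *\<^sub>R outer_square (state (Suc t) w) =
      (\<Sum>s\<in>paths t. indicator {r. \<forall>k\<le>t. r k = s k} (\<lambda>n. \<omega> n w) *\<^sub>R
        (indicator {w. \<omega> (Suc t) w = j} w *\<^sub>R outer_square (?P s *v x0 w)))"
      using sum_paths[of t "\<lambda>n. \<omega> n w" "\<lambda>s. indicator {w. \<omega> (Suc t) w = j} w *\<^sub>R outer_square (?P s *v x0 w)"]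
      by (simp add: state_eq)
    also have "\<dots> = (\<Sum>s\<in>paths t. indicator (?E s) (\<lambda>n. \<omega> n w) *\<^sub>R outer_square (?P s *v x0 w))"
      by (intro sum.cong) (auto simp: indicator_def)
    finally show ?thesis .
  qed
  have "mode_corr M \<omega> x0 A B K j (Suc t) =
      (\<integral>w. indicator {w. \<omega> (Suc t) w = j} w *\<^sub>R outer_square (state (Suc t) w) \<partial>M)"
    by (simp only: mode_corr_def state_def)
  also have "\<dots> = (\<Sum>s\<in>paths t. \<integral>w. indicator (?E s) (\<lambda>n. \<omega> n w) *\<^sub>R outer_square (?P s *v x0 w) \<partial>M)"
    unfolding pt by (intro Bochner_Integration.integral_sum integrable_event_outer E)
  also have "\<dots> = (\<Sum>s\<in>paths t. (path_prob t s * p (s t) j) *\<^sub>R (?P s ** second_moment D ** transpose (?P s)))"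
    by (simp only: integral_event_outer[OF E] mem_Collect_eq path_prob_step)
  \<comment> \<open>A sum over all modes, in which only \<open>i = s t\<close> survives, is inserted
    so that exchanging the two sums groups the paths by their mode at time \<open>t\<close>.\<close>
  also have "\<dots> = (\<Sum>s\<in>paths t. \<Sum>i\<in>UNIV. p i j *\<^sub>R (closed_loop i ** ((if s t = i then 1 else 0) *\<^sub>R (path_prob t s *\<^sub>R
      (transition closed_loop s t ** second_moment D ** transpose (transition closed_loop s t)))) ** transpose (closed_loop i)))"
  proof (rule sum.cong[OF refl])
    fix s
    let ?X = "transition closed_loop s t ** second_moment D ** transpose (transition closed_loop s t)"
    have "(\<Sum>i\<in>UNIV. p i j *\<^sub>R (closed_loop i ** ((if s t = i then 1 else 0) *\<^sub>R (path_prob t s *\<^sub>R ?X)) ** transpose (closed_loop i)))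
      = (\<Sum>i\<in>UNIV. if s t = i then (path_prob t s * p i j) *\<^sub>R (closed_loop i ** ?X ** transpose (closed_loop i)) else 0)"
      by (intro sum.cong) (auto simp: matrix_mult_scaleR mult.commute)
    then show "(path_prob t s * p (s t) j) *\<^sub>R (?P s ** second_moment D ** transpose (?P s)) =
      (\<Sum>i\<in>UNIV. p i j *\<^sub>R (closed_loop i ** ((if s t = i then 1 else 0) *\<^sub>R (path_prob t s *\<^sub>R ?X)) ** transpose (closed_loop i)))"
      by (simp add: matrix_transpose_mul matrix_mul_assoc)
  qed
  also have "\<dots> = lyap p closed_loop (\<lambda>i. mode_corr M \<omega> x0 A B K i t) j"
    unfolding lyap_def mode_corr_eq_sum_paths
    by (subst sum.swap) (simp only: linear_sum[OF bounded_linear.linear[OF bounded_linear_congruence]] scaleR_sum_right)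
  finally show ?thesis .
qed

lemma transpose_mode_corr: "transpose (mode_corr M \<omega> x0 A B K i t) = mode_corr M \<omega> x0 A B K i t"
  using integral_bounded_linear[OF bounded_linear_transpose integrable_mode_outer_state, of t i]
  by (simp add: mode_corr_def state_def linear_scale[OF bounded_linear.linear[OF bounded_linear_transpose]] transpose_outer_square)

lemma
  shows integrable_mode_inner_state:
    "integrable M (\<lambda>w. indicator {w. \<omega> t w = i} w * (v \<bullet> state t w)\<^sup>2)"
  and inner_mode_corr:
    "v \<bullet> (mode_corr M \<omega> x0 A B K i t *v v) = (\<integral>w. indicator {w. \<omega> t w = i} w * (v \<bullet> state t w)\<^sup>2 \<partial>M)"
proof -
  have eq: "v \<bullet> ((indicator {w. \<omega> t w = i} w *\<^sub>R outer_square (state t w)) *v v) =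
      indicator {w. \<omega> t w = i} w * (v \<bullet> state t w)\<^sup>2" for w
    by (simp add: inner_outer_square flip: scaleR_matrix_vector_assoc)
  show "integrable M (\<lambda>w. indicator {w. \<omega> t w = i} w * (v \<bullet> state t w)\<^sup>2)"
    using integrable_bounded_linear[OF bounded_linear_quadratic_form integrable_mode_outer_state, of v t i]
    unfolding eq .
  show "v \<bullet> (mode_corr M \<omega> x0 A B K i t *v v) = (\<integral>w. indicator {w. \<omega> t w = i} w * (v \<bullet> state t w)\<^sup>2 \<partial>M)"
    using integral_bounded_linear[OF bounded_linear_quadratic_form integrable_mode_outer_state, of v t i]
    unfolding eq by (simp add: mode_corr_def state_def)
qed

lemma mode_corr_psd: "0 \<le> v \<bullet> (mode_corr M \<omega> x0 A B K i t *v v)"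
  unfolding inner_mode_corr by (intro Bochner_Integration.integral_nonneg) simp

text \<open>Splitting by current mode and by coordinate gives finitely many integrable
  squares.\<close>

lemma integrable_norm_state: "integrable M (\<lambda>w. (norm (state t w))\<^sup>2)"
proof -
  have "(norm (state t w))\<^sup>2 = (\<Sum>i\<in>UNIV. \<Sum>a\<in>UNIV. indicator {w. \<omega> t w = i} w * (axis a 1 \<bullet> state t w)\<^sup>2)" for w
  proof -
    have "(\<Sum>i\<in>UNIV. \<Sum>a\<in>UNIV. indicator {w. \<omega> t w = i} w * (axis a 1 \<bullet> state t w)\<^sup>2)
      = (\<Sum>i\<in>UNIV. if \<omega> t w = i then (\<Sum>a\<in>UNIV. (axis a 1 \<bullet> state t w)\<^sup>2) else 0)"
      by (intro sum.cong) (auto simp: indicator_def)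
    then show ?thesis
      by (simp add: power2_norm_eq_inner inner_axis') (simp add: inner_vec_def power2_eq_square)
  qed
  then show ?thesis
    by (simp only:) (intro Bochner_Integration.integrable_sum integrable_mode_inner_state)
qed

lemma inner_mode_corr_le:
  "v \<bullet> (mode_corr M \<omega> x0 A B K i t *v v) \<le> (norm v)\<^sup>2 * expectation (\<lambda>w. (norm (state t w))\<^sup>2)"
proof -
  have "v \<bullet> (mode_corr M \<omega> x0 A B K i t *v v) \<le> (\<integral>w. (norm v)\<^sup>2 * (norm (state t w))\<^sup>2 \<partial>M)"
    unfolding inner_mode_corr
  proof (intro integral_mono integrable_mode_inner_state integrable_mult_right integrable_norm_state)
    fix w
    have "(v \<bullet> state t w)\<^sup>2 \<le> (norm v)\<^sup>2 * (norm (state t w))\<^sup>2"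
      using power_mono[OF Cauchy_Schwarz_ineq2[of v "state t w"], of 2] by (simp add: power_mult_distrib)
    then show "indicator {w. \<omega> t w = i} w * (v \<bullet> state t w)\<^sup>2 \<le> (norm v)\<^sup>2 * (norm (state t w))\<^sup>2"
      by (simp add: indicator_def)
  qed
  then show ?thesis by simp
qed

section \<open>Bounds from the cost and from the initial distribution\<close>

lemma Lambda_min_pos: "0 < Lambda_min Q"
  and Lambda_min_le: "Lambda_min Q * (norm x)\<^sup>2 \<le> x \<bullet> (Q i *v x)"
proof -
  show "0 < Lambda_min Q"
    unfolding Lambda_min_def using min_sv_pos_def(1)[OF Q_pos_def] by (subst Min_gr_iff) auto
  have "Lambda_min Q \<le> min_sv (Q i)" unfolding Lambda_min_def by (rule Min_le) auto
  then show "Lambda_min Q * (norm x)\<^sup>2 \<le> x \<bullet> (Q i *v x)"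
    using min_sv_pos_def(2)[OF Q_pos_def[of i], of x] by (meson mult_right_mono order_trans zero_le_power2)
qed

lemma stage_cost_ge: "Lambda_min Q * (norm x)\<^sup>2 \<le> stage_cost (Q i) (R i) x u"
proof -
  have "0 \<le> u \<bullet> (R i *v u)" using R_pos_def[of i] by (cases "u = 0") (auto simp: pos_def_def less_imp_le)
  then show ?thesis using Lambda_min_le[of x i] by (simp add: stage_cost_def)
qed

text \<open>Each stage cost dominates \<open>Lambda_min Q\<close> times the squared norm of the
  state, pointwise. The comparison runs in \<open>ennreal\<close>, where the cost series always has
  a value; finiteness of the cost allows the return to the reals.\<close>

lemma sum_norm_state_le_cost:
  assumes "cost M \<omega> x0 A B Q R K < \<infinity>"
  shows "Lambda_min Q * (\<Sum>t<n. expectation (\<lambda>w. (norm (state t w))\<^sup>2)) \<le> enn2real (cost M \<omega> x0 A B Q R K)"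
proof -
  let ?f = "\<lambda>t w. Lambda_min Q * (norm (state t w))\<^sup>2"
  let ?c = "\<lambda>t w. ennreal (stage_cost (Q (\<omega> t w)) (R (\<omega> t w)) (state t w) (- (K (\<omega> t w) *v state t w)))"
  have f0: "0 \<le> ?f t w" for t w using Lambda_min_pos by simp
  have fint: "integrable M (\<lambda>w. \<Sum>t<n. ?f t w)"
    by (intro Bochner_Integration.integrable_sum integrable_mult_right integrable_norm_state)
  have "Lambda_min Q * (\<Sum>t<n. expectation (\<lambda>w. (norm (state t w))\<^sup>2)) = (\<integral>w. (\<Sum>t<n. ?f t w) \<partial>M)"
    by (simp add: integrable_norm_state sum_distrib_left)
  then have "ennreal (Lambda_min Q * (\<Sum>t<n. expectation (\<lambda>w. (norm (state t w))\<^sup>2))) =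
      (\<integral>\<^sup>+ w. ennreal (\<Sum>t<n. ?f t w) \<partial>M)"
    using nn_integral_eq_integral[OF fint] f0 by (simp add: sum_nonneg)
  also have "\<dots> \<le> (\<integral>\<^sup>+ w. (\<Sum>t. ?c t w) \<partial>M)"
  proof (rule nn_integral_mono)
    fix w
    have "ennreal (\<Sum>t<n. ?f t w) = (\<Sum>t<n. ennreal (?f t w))" using f0 by simp
    also have "\<dots> \<le> (\<Sum>t<n. ?c t w)" by (intro sum_mono ennreal_leI stage_cost_ge)
    also have "\<dots> \<le> (\<Sum>t. ?c t w)" by (rule sum_le_suminf) auto
    finally show "ennreal (\<Sum>t<n. ?f t w) \<le> (\<Sum>t. ?c t w)" .
  qed
  also have "\<dots> = cost M \<omega> x0 A B Q R K" by (simp add: cost_def state_def Let_def)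
  finally have "ennreal (Lambda_min Q * (\<Sum>t<n. expectation (\<lambda>w. (norm (state t w))\<^sup>2))) \<le> cost M \<omega> x0 A B Q R K" .
  then show ?thesis
    using enn2real_mono[OF _ assms[unfolded infinity_ennreal_def]] Lambda_min_pos
    by (metis (no_types, lifting) Bochner_Integration.integral_nonneg enn2real_ennreal less_imp_le mult_nonneg_nonneg
        sum_nonneg zero_le_power2)
qed

lemma inner_sum_mode_corr_le:
  assumes "cost M \<omega> x0 A B Q R K < \<infinity>"
  shows "v \<bullet> ((\<Sum>t<n. mode_corr M \<omega> x0 A B K i t) *v v) \<le>
    enn2real (cost M \<omega> x0 A B Q R K) / Lambda_min Q * (norm v)\<^sup>2"
proof -
  let ?e = "\<Sum>t<n. expectation (\<lambda>w. (norm (state t w))\<^sup>2)"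
  have "v \<bullet> ((\<Sum>t<n. mode_corr M \<omega> x0 A B K i t) *v v) \<le> (\<Sum>t<n. (norm v)\<^sup>2 * expectation (\<lambda>w. (norm (state t w))\<^sup>2))"
    unfolding sum_matrix_vector_mult inner_sum_right by (intro sum_mono inner_mode_corr_le)
  also have "\<dots> = ?e * (norm v)\<^sup>2" by (simp add: sum_distrib_left mult.commute)
  also have "?e \<le> enn2real (cost M \<omega> x0 A B Q R K) / Lambda_min Q"
    using sum_norm_state_le_cost[OF assms, of n] Lambda_min_pos by (simp add: pos_le_divide_eq mult.commute)
  finally show ?thesis by (simp add: mult_right_mono)
qed

end

text \<open>The matrix \<open>\<pi> i *\<^sub>R second_moment D\<close> is the inhomogeneity
  \<open>W i\<close> of the iteration, and \<open>mu\<close> serves as its lower bound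
  \<open>m\<close>.\<close>

lemma mu_pos: "0 < mu \<pi> D"
  and mu_le: "mu \<pi> D * (norm v)\<^sup>2 \<le> v \<bullet> ((\<pi> i *\<^sub>R second_moment D) *v v)"
proof -
  have "0 < (MIN i. \<pi> i)" using pi_pos by (subst Min_gr_iff) auto
  then show "0 < mu \<pi> D" unfolding mu_def using min_sv_pos_def(1)[OF second_moment_pos_def] by simp
  have "(MIN i. \<pi> i) \<le> \<pi> i" by (rule Min_le) auto
  then have "(MIN i. \<pi> i) * (min_sv (second_moment D) * (norm v)\<^sup>2) \<le> \<pi> i * (v \<bullet> (second_moment D *v v))"
    using min_sv_pos_def[OF second_moment_pos_def] pi_pos[of i]
    by (intro mult_mono) (auto simp: less_imp_le)
  then show "mu \<pi> D * (norm v)\<^sup>2 \<le> v \<bullet> ((\<pi> i *\<^sub>R second_moment D) *v v)"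
    by (simp add: mu_def mult.assoc flip: scaleR_matrix_vector_assoc)
qed

end

subsection \<open>Perturbation of the policy\<close>

lemma max_sv_le_tuple_norm: "max_sv (V i) \<le> tuple_norm V"
  unfolding tuple_norm_def by (rule Max_ge) auto

lemma lyap_sum:
  "lyap p F (\<lambda>i. \<Sum>t\<in>T. V t i) j = (\<Sum>t\<in>T. lyap p F (V t) j)"
  unfolding lyap_def
  by (subst sum.swap)
    (simp only: linear_sum[OF bounded_linear.linear[OF bounded_linear_congruence]] scaleR_sum_right)

text \<open>Removes the mode-dependent closed-loop norms in favour of system variables, as needed
  for a polynomial coefficient.\<close>

lemma max_sv_closed_loop_le:
  "max_sv (A i - B i ** K i) \<le> tuple_norm A + tuple_norm B * tuple_norm K"
proof (rule max_sv_leI)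
  fix x
  have "norm ((A i - B i ** K i) *v x) \<le> norm (A i *v x) + norm (B i *v (K i *v x))"
    by (simp add: matrix_vector_mult_diff_rdistrib norm_triangle_ineq4 flip: matrix_vector_mul_assoc)
  also have "\<dots> \<le> max_sv (A i) * norm x + max_sv (B i) * (max_sv (K i) * norm x)"
    by (intro add_mono norm_matrix_vector_le_max_sv
        order_trans[OF norm_matrix_vector_le_max_sv mult_left_mono] max_sv_nonneg)
  also have "\<dots> \<le> tuple_norm A * norm x + tuple_norm B * (tuple_norm K * norm x)"
    by (intro add_mono mult_mono max_sv_le_tuple_norm)
      (auto intro: max_sv_nonneg mult_nonneg_nonneg order_trans[OF max_sv_nonneg max_sv_le_tuple_norm])
  finally show "norm ((A i - B i ** K i) *v x) \<le> (tuple_norm A + tuple_norm B * tuple_norm K) * norm x"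
    by (simp add: algebra_simps)
qed

context mjls
begin

text \<open>Splitting off time \<open>0\<close> leaves the shifted terms, which are images under the
  linear operator \<open>lyap\<close>; this is the affine recursion of the perturbation
  argument.\<close>

lemma partial_sum_mode_corr_Suc:
  "(\<Sum>t<Suc n. mode_corr M \<omega> x0 A B K j t) =
    \<pi> j *\<^sub>R second_moment D + lyap p (closed_loop K) (\<lambda>i. \<Sum>t<n. mode_corr M \<omega> x0 A B K i t) j"
  by (simp add: sum.lessThan_Suc_shift mode_corr_0 mode_corr_Suc lyap_sum del: sum.lessThan_Suc)

text \<open>The difference of the closed loops is \<open>B i ** (K' i - K i)\<close> up to sign.
  Their sum is that difference plus twice the unperturbed loop; the threshold \<open>2\<close> in
  \<open>small\<close> turns this into \<open>2 * (max_sv (A i - B i ** K i) + 1)\<close>.\<close>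

lemma closed_loop_perturbation:
  assumes small: "\<And>i. max_sv (B i) * \<delta> \<le> 2" and \<delta>: "\<And>i. max_sv (K' i - K i) \<le> \<delta>"
  shows "norm (transpose (closed_loop K' i) *v x - transpose (closed_loop K i) *v x)
      * norm (transpose (closed_loop K' i) *v x + transpose (closed_loop K i) *v x)
    \<le> 2 * \<delta> * (max_sv (B i) * (max_sv (A i - B i ** K i) + 1)) * (norm x)\<^sup>2"
proof -
  let ?u = "transpose (closed_loop K i) *v x" and ?u' = "transpose (closed_loop K' i) *v x"
  have \<delta>0: "0 \<le> \<delta>" using order_trans[OF max_sv_nonneg \<delta>] .
  have "transpose (closed_loop K i) - transpose (closed_loop K' i) = transpose (closed_loop K i - closed_loop K' i)"
    by (simp add: transpose_def vec_eq_iff)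
  also have "closed_loop K i - closed_loop K' i = B i ** (K' i - K i)"
  proof -
    have "B i ** K' i = B i ** K i + B i ** (K' i - K i)" by (simp flip: matrix_add_ldistrib)
    then show ?thesis by (simp add: closed_loop_def)
  qed
  finally have "?u - ?u' = transpose (K' i - K i) *v (transpose (B i) *v x)"
    by (simp add: matrix_transpose_mul matrix_vector_mul_assoc flip: matrix_vector_mult_diff_rdistrib)
  also have "norm \<dots> \<le> max_sv (K' i - K i) * norm (transpose (B i) *v x)"
    by (rule max_sv_transpose_vector)
  also have "\<dots> \<le> \<delta> * (max_sv (B i) * norm x)"
    by (intro mult_mono \<delta> max_sv_transpose_vector \<delta>0 norm_ge_zero)
  finally have d: "norm (?u' - ?u) \<le> \<delta> * max_sv (B i) * norm x"
    by (simp add: norm_minus_commute mult.assoc)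
  have "norm (?u' + ?u) = norm ((?u' - ?u) + 2 *\<^sub>R ?u)" by (simp add: scaleR_2 add.commute)
  also have "\<dots> \<le> norm (?u' - ?u) + norm (2 *\<^sub>R ?u)" by (rule norm_triangle_ineq)
  also have "\<dots> \<le> 2 * norm x + 2 * (max_sv (A i - B i ** K i) * norm x)"
  proof (rule add_mono)
    show "norm (?u' - ?u) \<le> 2 * norm x"
      using d mult_right_mono[OF small[of i] norm_ge_zero[of x]] by (simp add: mult.commute)
    show "norm (2 *\<^sub>R ?u) \<le> 2 * (max_sv (A i - B i ** K i) * norm x)"
      using max_sv_transpose_vector[of "A i - B i ** K i" x] by (simp add: closed_loop_def)
  qed
  finally have s: "norm (?u' + ?u) \<le> 2 * (max_sv (A i - B i ** K i) + 1) * norm x"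
    by (simp add: algebra_simps)
  have "norm (?u' - ?u) * norm (?u' + ?u) \<le>
      (\<delta> * max_sv (B i) * norm x) * (2 * (max_sv (A i - B i ** K i) + 1) * norm x)"
    by (intro mult_mono d s mult_nonneg_nonneg \<delta>0 max_sv_nonneg norm_ge_zero)
  then show ?thesis by (simp add: power2_eq_square mult_ac)
qed

text \<open>Compares the lower and upper bounds on the moment at time \<open>0\<close>, at a unit
  vector and in an arbitrary mode.\<close>

lemma mu_le_cost:
  assumes "cost M \<omega> x0 A B Q R K < \<infinity>"
  shows "mu \<pi> D \<le> enn2real (cost M \<omega> x0 A B Q R K) / Lambda_min Q"
proof -
  obtain v :: "real^'d" where v: "norm v = 1" by (meson vector_choose_size zero_le_one)
  show ?thesis
    using mu_le[of v undefined] inner_sum_mode_corr_le[OF assms, of v undefined 1] v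
    by (simp add: mode_corr_0)
qed

lemma
  fixes K K' :: "'s \<Rightarrow> real^'d^'k"
  defines "\<sigma> \<equiv> \<Sum>i\<in>UNIV. max_sv (B i) * (max_sv (A i - B i ** K i) + 1)"
    and "c \<equiv> enn2real (cost M \<omega> x0 A B Q R K) / Lambda_min Q"
  assumes fin: "cost M \<omega> x0 A B Q R K < \<infinity>"
    and \<delta>: "\<And>i. max_sv (K' i - K i) \<le> \<delta>"
    and small: "4 * c * \<sigma> * \<delta> \<le> mu \<pi> D"
  shows summable_mode_corr: "summable (mode_corr M \<omega> x0 A B K i)"
    and summable_mode_corr_perturbed: "summable (mode_corr M \<omega> x0 A B K' i)"
    and chi_mat_diff_le:
      "max_sv (chi_mat M \<omega> x0 A B K' - chi_mat M \<omega> x0 A B K) \<le> 4 / mu \<pi> D * c\<^sup>2 * \<sigma> * \<delta>"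
proof -
  let ?X = "mode_corr M \<omega> x0 A B K" and ?X' = "mode_corr M \<omega> x0 A B K'"
  define \<epsilon> where "\<epsilon> i = 2 * \<delta> * (max_sv (B i) * (max_sv (A i - B i ** K i) + 1))" for i
  have \<epsilon>: "(\<Sum>i\<in>UNIV. \<epsilon> i) = 2 * \<delta> * \<sigma>" by (simp add: \<epsilon>_def \<sigma>_def sum_distrib_left)
  have \<delta>0: "0 \<le> \<delta>" using order_trans[OF max_sv_nonneg \<delta>] .
  have c: "mu \<pi> D \<le> c" unfolding c_def by (rule mu_le_cost[OF fin])
  then have c0: "0 < c" using mu_pos by linarith
  \<comment> \<open>From \<open>4 * c * \<sigma> * \<delta> \<le> mu \<pi> D \<le> c\<close> one
    gets \<open>\<sigma> * \<delta> \<le> 1/4\<close>, and \<open>\<sigma>\<close> dominates each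
    \<open>max_sv (B i)\<close>.\<close>
  have B: "max_sv (B i) * \<delta> \<le> 2" for i
  proof -
    have "max_sv (B i) * 1 \<le> max_sv (B i) * (max_sv (A i - B i ** K i) + 1)"
      by (intro mult_left_mono max_sv_nonneg) (simp add: max_sv_nonneg)
    also have "\<dots> \<le> \<sigma>"
      unfolding \<sigma>_def by (rule member_le_sum) (simp_all add: max_sv_nonneg)
    finally have "c * (max_sv (B i) * \<delta>) \<le> c * (\<sigma> * \<delta>)"
      using c0 \<delta>0 by (intro mult_left_mono mult_right_mono) auto
    also have "\<dots> \<le> c * 2" proof -
      have "4 * c * \<sigma> * \<delta> = 4 * (c * (\<sigma> * \<delta>))" by simp
      then show ?thesis using small c c0 by linarith
    qed
    finally show ?thesis using c0 by simp
  qed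
  have p: "0 \<le> p i j" "p i j \<le> 1" for i j
  proof -
    show "0 \<le> p i j" for i j using chain by (simp add: markov_chain_def)
    then have "p i j \<le> (\<Sum>j\<in>UNIV. p i j)" by (intro member_le_sum) auto
    then show "p i j \<le> 1" using chain by (simp add: markov_chain_def)
  qed
  have X0_sym: "transpose (\<pi> j *\<^sub>R second_moment D) = \<pi> j *\<^sub>R second_moment D" for j
    using transpose_mode_corr[of K j 0] by (simp add: mode_corr_0)
  have S_0: "(\<Sum>t<0. mode_corr M \<omega> x0 A B L j t) = 0" for j L by simp
  \<comment> \<open>The factor \<open>4\<close> in \<open>small\<close> is the \<open>2\<close> of
    the iteration bound times the \<open>2\<close> in the sum of the
    \<open>\<epsilon> i\<close>.\<close>
  have small': "2 * c * (\<Sum>i\<in>UNIV. \<epsilon> i) \<le> mu \<pi> D" using small by (simp add: \<epsilon> mult_ac)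
  have diff: "norm (transpose (closed_loop K' i) *v x - transpose (closed_loop K i) *v x)
      * norm (transpose (closed_loop K' i) *v x + transpose (closed_loop K i) *v x) \<le> \<epsilon> i * (norm x)\<^sup>2" for i x
    unfolding \<epsilon>_def by (rule closed_loop_perturbation[OF B \<delta>])
  note pert = lyap_iteration_perturbation[where S = "\<lambda>n i. \<Sum>t<n. ?X i t" and S' = "\<lambda>n i. \<Sum>t<n. ?X' i t"
      and W = "\<lambda>j. \<pi> j *\<^sub>R second_moment D" and F = "closed_loop K" and F' = "closed_loop K'" and p = p,
      OF p diff X0_sym mu_le mu_pos S_0 partial_sum_mode_corr_Suc
        S_0 partial_sum_mode_corr_Suc inner_sum_mode_corr_le[OF fin, folded c_def] small']
  show sX: "summable (?X i)" for i
    by (rule summable_psd_matrix[OF transpose_mode_corr mode_corr_psd inner_sum_mode_corr_le[OF fin]])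
  \<comment> \<open>Only the cost of \<open>K\<close> is known to be finite, so the perturbed
    partial sums are bounded through \<open>pert(2)\<close>.\<close>
  show sX': "summable (?X' i)" for i
    by (rule summable_psd_matrix[OF transpose_mode_corr mode_corr_psd order_trans[OF abs_ge_self pert(2)]])
  define V where "V i = (\<Sum>t. ?X' i t) - (\<Sum>t. ?X i t)" for i
  \<comment> \<open>The relative error of the partial sums times their uniform bound
    \<open>c\<close>; being independent of \<open>n\<close>, it survives the limit.\<close>
  define b where "b = 2 * c * (\<Sum>i\<in>UNIV. \<epsilon> i) / mu \<pi> D * c"
  have "0 \<le> \<sigma>" unfolding \<sigma>_def by (intro sum_nonneg mult_nonneg_nonneg add_nonneg_nonneg max_sv_nonneg zero_le_one)
  then have r0: "0 \<le> 2 * c * (\<Sum>i\<in>UNIV. \<epsilon> i) / mu \<pi> D"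
    using c0 \<delta>0 mu_pos by (simp add: \<epsilon>)
  then have b0: "0 \<le> b" unfolding b_def using c0 by (intro mult_nonneg_nonneg) auto
  have V_sym: "transpose (V i) = V i" for i
  proof -
    have "transpose (\<Sum>t. mode_corr M \<omega> x0 A B L i t) = (\<Sum>t. mode_corr M \<omega> x0 A B L i t)"
      if "summable (mode_corr M \<omega> x0 A B L i)" for L
      using bounded_linear.suminf[OF bounded_linear_transpose that] by (simp add: transpose_mode_corr)
    then show ?thesis
      unfolding V_def using sX sX' by (simp add: linear_diff[OF bounded_linear.linear[OF bounded_linear_transpose]])
  qed
  have V_bd: "\<bar>v \<bullet> (V i *v v)\<bar> \<le> b * (norm v)\<^sup>2" for i v
  proof (rule tendsto_upperbound)
    show "(\<lambda>n. \<bar>v \<bullet> ((\<Sum>t<n. ?X' i t) *v v) - v \<bullet> ((\<Sum>t<n. ?X i t) *v v)\<bar>) \<longlonglongrightarrow> \<bar>v \<bullet> (V i *v v)\<bar>"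
      unfolding V_def matrix_vector_mult_diff_rdistrib inner_diff_right
      by (intro tendsto_rabs tendsto_diff bounded_linear.tendsto[OF bounded_linear_quadratic_form]
          summable_LIMSEQ sX sX')
    have "\<bar>v \<bullet> ((\<Sum>t<n. ?X' i t) *v v) - v \<bullet> ((\<Sum>t<n. ?X i t) *v v)\<bar> \<le> b * (norm v)\<^sup>2" for n
      using order_trans[OF pert(1) mult_left_mono[OF inner_sum_mode_corr_le[OF fin, folded c_def] r0]]
      by (simp add: b_def mult.assoc)
    then show "\<forall>\<^sub>F n in sequentially. \<bar>v \<bullet> ((\<Sum>t<n. ?X' i t) *v v) - v \<bullet> ((\<Sum>t<n. ?X i t) *v v)\<bar> \<le> b * (norm v)\<^sup>2"
      by simp
  qed simp
  have "chi_mat M \<omega> x0 A B K' - chi_mat M \<omega> x0 A B K = block_diag V"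
    by (simp add: chi_mat_def block_diag_def V_def vec_eq_iff)
  moreover have "max_sv (block_diag V) \<le> b"
    by (intro max_sv_leI norm_block_diag_le symmetric_norm_bound V_sym V_bd b0)
  ultimately show "max_sv (chi_mat M \<omega> x0 A B K' - chi_mat M \<omega> x0 A B K) \<le> 4 / mu \<pi> D * c\<^sup>2 * \<sigma> * \<delta>"
    by (simp add: b_def \<epsilon> power2_eq_square mult_ac)
qed

end

text \<open>The case \<open>c = 0\<close> matters: it occurs when every \<open>B i\<close> vanishes,
  the quotient may then be infinite, and the product is zero.\<close>

lemma ennreal_mult_le_of_le_divide:
  fixes a b c :: ennreal
  assumes "a \<le> b / c" "c \<noteq> \<infinity>"
  shows "a * c \<le> b"
proof (cases "c = 0")
  case False
  have "a * c \<le> b / c * c" using assms(1) by (rule mult_right_mono) simp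
  also have "\<dots> = b" using False assms(2) by (simp add: ennreal_divide_times ennreal_divide_self top.not_eq_extremum)
  finally show ?thesis .
qed simp

theorem lemma5:
  fixes M :: "'w measure"
    and \<omega> :: "nat \<Rightarrow> 'w \<Rightarrow> 's::finite"
    and p :: "'s \<Rightarrow> 's \<Rightarrow> real"
    and \<pi> :: "'s \<Rightarrow> real"
    and x0 :: "'w \<Rightarrow> real^'d"
    and D :: "(real^'d) measure"
    and A :: "'s \<Rightarrow> real^'d^'d"
    and B :: "'s \<Rightarrow> real^'k^'d"
    and Q :: "'s \<Rightarrow> real^'d^'d"
    and R :: "'s \<Rightarrow> real^'k^'k"
  assumes "mjls M \<omega> p \<pi> x0 D A B Q R"
  shows "\<exists>g :: real \<times> real \<times> real \<times> real \<times> real \<times> real \<Rightarrow> real.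
    real_polynomial_function g \<and>
    (\<forall>K K' :: 's \<Rightarrow> real^'d^'k.
       cost M \<omega> x0 A B Q R K < \<infinity> \<longrightarrow>
       ennreal (tuple_norm (\<lambda>i. K' i - K i)) \<le>
         min (ennreal (Lambda_min Q * mu \<pi> D) /
                (4 * cost M \<omega> x0 A B Q R K *
                 ennreal (\<Sum>i\<in>UNIV. max_sv (B i) * (max_sv (A i - B i ** K i) + 1))))
             (ennreal (\<Sum>i\<in>UNIV. max_sv (K i))) \<longrightarrow>
       (\<forall>i. summable (mode_corr M \<omega> x0 A B K i)) \<and>
       (\<forall>i. summable (mode_corr M \<omega> x0 A B K' i)) \<and>
       max_sv (chi_mat M \<omega> x0 A B K' - chi_mat M \<omega> x0 A B K) \<le>
         g (tuple_norm A, tuple_norm B, tuple_norm Q, tuple_norm R, tuple_norm K,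
            enn2real (cost M \<omega> x0 A B Q R K) / Lambda_min Q)
         * tuple_norm (\<lambda>i. K' i - K i))"
proof -
  interpret mjls M \<omega> p \<pi> x0 D A B Q R by fact
  \<comment> \<open>The coefficient \<open>4 / mu \<pi> D * c\<^sup>2 * \<sigma>\<close> with
    \<open>\<sigma>\<close> replaced by a uniform bound. The projections select
    \<open>tuple_norm A\<close>, \<open>tuple_norm B\<close>, \<open>tuple_norm K\<close> and, as
    last component, \<open>c\<close>; \<open>mu\<close> and the number of modes are fixed by the
    system.\<close>
  define g :: "real \<times> real \<times> real \<times> real \<times> real \<times> real \<Rightarrow> real" where
    "g z = 4 / mu \<pi> D * (snd (snd (snd (snd (snd z)))) * snd (snd (snd (snd (snd z))))) *
      (real CARD('s) * (fst (snd z) * (fst z + fst (snd z) * fst (snd (snd (snd (snd z)))) + 1)))" for z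
  have "real_polynomial_function g"
    unfolding g_def[abs_def]
    by (intro real_polynomial_function.intros bounded_linear_fst_comp bounded_linear_snd_comp bounded_linear_ident)
  moreover have "(\<forall>i. summable (mode_corr M \<omega> x0 A B K i)) \<and> (\<forall>i. summable (mode_corr M \<omega> x0 A B K' i)) \<and>
       max_sv (chi_mat M \<omega> x0 A B K' - chi_mat M \<omega> x0 A B K) \<le>
         g (tuple_norm A, tuple_norm B, tuple_norm Q, tuple_norm R, tuple_norm K,
            enn2real (cost M \<omega> x0 A B Q R K) / Lambda_min Q) * tuple_norm (\<lambda>i. K' i - K i)"
    if fin: "cost M \<omega> x0 A B Q R K < \<infinity>"
      and le: "ennreal (tuple_norm (\<lambda>i. K' i - K i)) \<le> min (ennreal (Lambda_min Q * mu \<pi> D) /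
                (4 * cost M \<omega> x0 A B Q R K *
                 ennreal (\<Sum>i\<in>UNIV. max_sv (B i) * (max_sv (A i - B i ** K i) + 1))))
             (ennreal (\<Sum>i\<in>UNIV. max_sv (K i)))" for K K' :: "'s \<Rightarrow> real^'d^'k"
  proof -
    let ?\<sigma> = "\<Sum>i\<in>UNIV. max_sv (B i) * (max_sv (A i - B i ** K i) + 1)"
    define \<delta> where "\<delta> = tuple_norm (\<lambda>i. K' i - K i)"
    define C where "C = enn2real (cost M \<omega> x0 A B Q R K)"
    have C: "cost M \<omega> x0 A B Q R K = ennreal C" "0 \<le> C"
      using fin by (simp_all add: C_def less_top)
    have \<delta>: "max_sv (K' i - K i) \<le> \<delta>" for i unfolding \<delta>_def by (rule max_sv_le_tuple_norm)
    have \<delta>0: "0 \<le> \<delta>" using order_trans[OF max_sv_nonneg \<delta>] .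
    have \<sigma>0: "0 \<le> ?\<sigma>" by (intro sum_nonneg mult_nonneg_nonneg add_nonneg_nonneg max_sv_nonneg zero_le_one)
    have eq: "4 * cost M \<omega> x0 A B Q R K * ennreal ?\<sigma> = ennreal (4 * C * ?\<sigma>)"
      using C \<sigma>0 by (simp add: ennreal_mult)
    have "ennreal \<delta> \<le> ennreal (Lambda_min Q * mu \<pi> D) / ennreal (4 * C * ?\<sigma>)"
      using le unfolding eq \<delta>_def by simp
    then have "ennreal \<delta> * ennreal (4 * C * ?\<sigma>) \<le> ennreal (Lambda_min Q * mu \<pi> D)"
      by (rule ennreal_mult_le_of_le_divide) simp
    then have "\<delta> * (4 * C * ?\<sigma>) \<le> Lambda_min Q * mu \<pi> D"
      using \<delta>0 C(2) \<sigma>0 Lambda_min_pos mu_pos by (simp flip: ennreal_mult)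
    \<comment> \<open>Dividing by \<open>Lambda_min Q\<close> brings the radius condition into the
      form required by \<open>chi_mat_diff_le\<close>, with
      \<open>c = C / Lambda_min Q\<close>.\<close>
    then have small: "4 * (C / Lambda_min Q) * ?\<sigma> * \<delta> \<le> mu \<pi> D"
      using Lambda_min_pos by (simp add: pos_divide_le_eq mult_ac)
    have "?\<sigma> \<le> (\<Sum>i\<in>(UNIV::'s set). tuple_norm B * (tuple_norm A + tuple_norm B * tuple_norm K + 1))"
      by (intro sum_mono mult_mono add_mono max_sv_le_tuple_norm max_sv_closed_loop_le order_refl
          order_trans[OF max_sv_nonneg max_sv_le_tuple_norm] add_nonneg_nonneg max_sv_nonneg zero_le_one)
    then have "4 / mu \<pi> D * (C / Lambda_min Q)\<^sup>2 * ?\<sigma> \<le>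
        g (tuple_norm A, tuple_norm B, tuple_norm Q, tuple_norm R, tuple_norm K, C / Lambda_min Q)"
      using mult_left_mono[of ?\<sigma> _ "4 / mu \<pi> D * (C / Lambda_min Q)\<^sup>2"] mu_pos
      by (simp add: g_def power2_eq_square)
    then have "4 / mu \<pi> D * (C / Lambda_min Q)\<^sup>2 * ?\<sigma> * \<delta> \<le>
        g (tuple_norm A, tuple_norm B, tuple_norm Q, tuple_norm R, tuple_norm K, C / Lambda_min Q) * \<delta>"
      using \<delta>0 by (rule mult_right_mono)
    then show ?thesis
      using summable_mode_corr[OF fin \<delta> small[unfolded C_def]]
        summable_mode_corr_perturbed[OF fin \<delta> small[unfolded C_def]]
        chi_mat_diff_le[OF fin \<delta> small[unfolded C_def]]
      unfolding \<delta>_def[symmetric] C_def[symmetric] by (blast intro: order_trans)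
  qed
  ultimately show ?thesis by blast
qed

end
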